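(* Let $\phi:(M,g)\to(N,h)$ be a smooth map between Riemannian manifolds and let $f:M\to(0,+\infty)$ be a smooth function. Then the $f$-bi-tension field $\tau_{2,f}(\phi)$ and the bi-tension field $\tau_2(\phi)$ are related by $$\tau_{2,f}(\phi)=f\,\tau_2(\phi)-\Delta(f)\,\tau(\phi)-2\nabla^\phi_{\mathrm{grad}_gf}\,\tau(\phi),$$ where $\tau_2(\phi)=-\mathrm{Tr}_g(\nabla^\phi)^2\tau(\phi)-\mathrm{Tr}_gR^N(\tau(\phi),d\phi)d\phi$.
   Context: Curvature convention: $R(X,Y)Z=\nabla_X\nabla_YZ-\nabla_Y\nabla_XZ-\nabla_{[X,Y]}Z$. $\nabla^\phi$ is the pull-back connection on $\phi^{-1}TN$, $\tau(\phi)=\mathrm{Tr}_g\nabla d\phi$ is the tension field, $\Delta=\mathrm{div}\,\mathrm{grad}$ on $(M,g)$. For a local orthonormal frame $\{e_i\}$ and a section $V$ of $\phi^{-1}TN$: $\mathrm{Tr}_g(\nabla^\phi)^2V=\sum_i\big(\nabla^\phi_{e_i}\nabla^\phi_{e_i}V-\nabla^\phi_{\nabla_{e_i}e_i}V\big)$ and $\mathrm{Tr}_gR^N(V,d\phi)d\phi=\sum_iR^N(V,d\phi(e_i))d\phi(e_i)$. The $f$-bi-tension field (the Euler–Lagrange operator of the $f$-bi-energy $E_{2,f}(\phi)=\frac12\int_\Omega f|\tau(\phi)|^2dv_g$) is $$\tau_{2,f}(\phi)=-\mathrm{Tr}_g(\nabla^\phi)^2\big(f\tau(\phi)\big)-f\,\mathrm{Tr}_gR^N(\tau(\phi),d\phi)d\phi.$$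 *)

theory Defs
  imports "HOL-Analysis.Analysis" "HOL-Library.Function_Algebras"
begin

section \<open>Smooth manifolds\<close>

text \<open>The set \<open>S\<close> is meant to be open.\<close>

fun Ck_on :: "nat \<Rightarrow> 'a::euclidean_space set \<Rightarrow> ('a \<Rightarrow> 'b::real_normed_vector) \<Rightarrow> bool" where
  "Ck_on 0 S F \<longleftrightarrow> continuous_on S F"
| "Ck_on (Suc k) S F \<longleftrightarrow>
     (\<forall>x\<in>S. F differentiable (at x)) \<and> (\<forall>a. Ck_on k S (\<lambda>x. frechet_derivative F (at x) a))"

definition smooth_on :: "'a::euclidean_space set \<Rightarrow> ('a \<Rightarrow> 'b::real_normed_vector) \<Rightarrow> bool" where
  "smooth_on S F \<longleftrightarrow> (\<forall>k. Ck_on k S F)"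

text \<open>A manifold consists of a topology and an atlas; a chart is a pair of a domain \<open>U\<close> and a map
  \<open>\<psi>\<close>, whose values outside \<open>U\<close> are irrelevant. The atlas need not be maximal.\<close>

type_synonym ('m, 'a) chart = "'m set \<times> ('m \<Rightarrow> 'a)"

record ('m, 'a) manifold =
  mtop :: "'m topology"
  charts :: "('m, 'a) chart set"

abbreviation points :: "('m, 'a) manifold \<Rightarrow> 'm set" where
  "points M \<equiv> topspace (mtop M)"

definition smooth_manifold :: "('m, 'a::euclidean_space) manifold \<Rightarrow> bool" where
  "smooth_manifold M \<longleftrightarrow>
     Hausdorff_space (mtop M) \<and> second_countable (mtop M) \<and>
     (\<Union>(U, \<psi>)\<in>charts M. U) = points M \<and>
     (\<forall>(U, \<psi>)\<in>charts M. openin (mtop M) U \<and> open (\<psi> ` U) \<and>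
        homeomorphic_map (subtopology (mtop M) U) (top_of_set (\<psi> ` U)) \<psi>) \<and>
     (\<forall>(U, \<psi>)\<in>charts M. \<forall>(U', \<psi>')\<in>charts M.
        smooth_on (\<psi> ` (U \<inter> U')) (\<psi>' \<circ> inv_into U \<psi>))"

definition smooth_fun :: "('m, 'a::euclidean_space) manifold \<Rightarrow> 'm set \<Rightarrow> ('m \<Rightarrow> real) \<Rightarrow> bool" where
  "smooth_fun M W u \<longleftrightarrow> (\<forall>(U, \<psi>)\<in>charts M. smooth_on (\<psi> ` (U \<inter> W)) (u \<circ> inv_into U \<psi>))"

definition smooth_near :: "('m, 'a::euclidean_space) manifold \<Rightarrow> 'm \<Rightarrow> ('m \<Rightarrow> real) \<Rightarrow> bool" where
  "smooth_near M p u \<longleftrightarrow> (\<exists>W. openin (mtop M) W \<and> p \<in> W \<and> smooth_fun M W u)"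

definition smooth_map ::
    "('m, 'a::euclidean_space) manifold \<Rightarrow> ('n, 'b::euclidean_space) manifold \<Rightarrow> ('m \<Rightarrow> 'n) \<Rightarrow> bool" where
  "smooth_map M N \<phi> \<longleftrightarrow> continuous_map (mtop M) (mtop N) \<phi> \<and>
     (\<forall>(U, \<psi>)\<in>charts M. \<forall>(U', \<eta>)\<in>charts N.
        smooth_on (\<psi> ` (U \<inter> \<phi> -` U')) (\<eta> \<circ> \<phi> \<circ> inv_into U \<psi>))"


section \<open>Tangent vectors and sections along a map\<close>

text \<open>Tangent vectors at \<open>p\<close> are the directional derivative operators at \<open>p\<close>, that is, the linear
  combinations of the coordinate derivations of a chart, acting on functions that are smooth near
  \<open>p\<close> and extended by 0 to all other functions. Sums and differences of tangent vectors are
  the pointwise ones of functions.\<close>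

type_synonym 'm tvec = "('m \<Rightarrow> real) \<Rightarrow> real"

definition tscale :: "real \<Rightarrow> 'm tvec \<Rightarrow> 'm tvec"  (infixr "\<cdot>" 75) where
  "r \<cdot> v = (\<lambda>u. r * v u)"

definition coord_vec ::
    "('m, 'a::euclidean_space) manifold \<Rightarrow> ('m, 'a) chart \<Rightarrow> 'm \<Rightarrow> 'a \<Rightarrow> 'm tvec" where
  "coord_vec M c p a = (\<lambda>u. if smooth_near M p u
     then frechet_derivative (u \<circ> inv_into (fst c) (snd c)) (at (snd c p)) a else 0)"

definition tangent_space :: "('m, 'a::euclidean_space) manifold \<Rightarrow> 'm \<Rightarrow> 'm tvec set" where
  "tangent_space M p = {coord_vec M c p a | c a. c \<in> charts M \<and> p \<in> fst c}"

definition differential ::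
    "('n, 'b::euclidean_space) manifold \<Rightarrow> ('m \<Rightarrow> 'n) \<Rightarrow> 'm \<Rightarrow> 'm tvec \<Rightarrow> 'n tvec" where
  "differential N \<phi> p v = (\<lambda>u. if smooth_near N (\<phi> p) u then v (u \<circ> \<phi>) else 0)"

text \<open>Smooth sections over \<open>U\<close> of the pull-back bundle of the tangent bundle of \<open>N\<close> under \<open>\<phi>\<close>.\<close>

definition section_along ::
    "('m, 'a::euclidean_space) manifold \<Rightarrow> ('n, 'b::euclidean_space) manifold \<Rightarrow> ('m \<Rightarrow> 'n) \<Rightarrow>
     'm set \<Rightarrow> ('m \<Rightarrow> 'n tvec) \<Rightarrow> bool" where
  "section_along M N \<phi> U V \<longleftrightarrow> (\<forall>p\<in>U. V p \<in> tangent_space N (\<phi> p)) \<and>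
     (\<forall>W u. openin (mtop N) W \<and> smooth_fun N W u \<longrightarrow> smooth_fun M (U \<inter> \<phi> -` W) (\<lambda>p. V p u))"

abbreviation vector_field ::
    "('m, 'a::euclidean_space) manifold \<Rightarrow> 'm set \<Rightarrow> ('m \<Rightarrow> 'm tvec) \<Rightarrow> bool" where
  "vector_field M U X \<equiv> section_along M M id U X"

definition lie_bracket ::
    "('m, 'a::euclidean_space) manifold \<Rightarrow> ('m \<Rightarrow> 'm tvec) \<Rightarrow> ('m \<Rightarrow> 'm tvec) \<Rightarrow> 'm \<Rightarrow> 'm tvec" where
  "lie_bracket M X Y p = (\<lambda>u. if smooth_near M p u
     then X p (\<lambda>q. Y q u) - Y p (\<lambda>q. X q u) else 0)"


section \<open>Riemannian metrics and connections\<close>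

definition riemannian_manifold ::
    "('m, 'a::euclidean_space) manifold \<Rightarrow> ('m \<Rightarrow> 'm tvec \<Rightarrow> 'm tvec \<Rightarrow> real) \<Rightarrow> bool" where
  "riemannian_manifold M g \<longleftrightarrow> smooth_manifold M \<and>
     (\<forall>p\<in>points M. \<forall>v\<in>tangent_space M p. \<forall>w\<in>tangent_space M p.
        g p v w = g p w v \<and>
        (\<forall>v'\<in>tangent_space M p. g p (v + v') w = g p v w + g p v' w) \<and>
        (\<forall>r. g p (r \<cdot> v) w = r * g p v w) \<and>
        (v \<noteq> 0 \<longrightarrow> g p v v > 0)) \<and>
     (\<forall>U X Y. openin (mtop M) U \<and> vector_field M U X \<and> vector_field M U Y \<longrightarrow>
        smooth_fun M U (\<lambda>p. g p (X p) (Y p)))"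

text \<open>A connection on the pull-back bundle is a covariant derivative \<open>D p v V\<close> of local
  sections \<open>V\<close> defined near \<open>p\<close> in the direction \<open>v\<close>; a section over \<open>U\<close> is a total function with
  irrelevant values outside \<open>U\<close>, hence the locality clause. With \<open>N = M\<close> and \<open>\<phi> = id\<close> this is
  an affine connection on \<open>M\<close>.\<close>

type_synonym ('m, 'n) cov = "'m \<Rightarrow> 'm tvec \<Rightarrow> ('m \<Rightarrow> 'n tvec) \<Rightarrow> 'n tvec"

definition connection_along ::
    "('m, 'a::euclidean_space) manifold \<Rightarrow> ('n, 'b::euclidean_space) manifold \<Rightarrow> ('m \<Rightarrow> 'n) \<Rightarrow>
     ('m, 'n) cov \<Rightarrow> bool" where
  "connection_along M N \<phi> D \<longleftrightarrow>
     (\<forall>U V. openin (mtop M) U \<and> section_along M N \<phi> U V \<longrightarrow>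
       (\<forall>p\<in>U. \<forall>v\<in>tangent_space M p.
          D p v V \<in> tangent_space N (\<phi> p) \<and>
          (\<forall>w\<in>tangent_space M p. D p (v + w) V = D p v V + D p w V) \<and>
          (\<forall>r. D p (r \<cdot> v) V = r \<cdot> D p v V) \<and>
          (\<forall>W. section_along M N \<phi> U W \<longrightarrow> D p v (\<lambda>q. V q + W q) = D p v V + D p v W) \<and>
          (\<forall>u. smooth_fun M U u \<longrightarrow> D p v (\<lambda>q. u q \<cdot> V q) = v u \<cdot> V p + u p \<cdot> D p v V) \<and>
          (\<forall>W. (\<forall>q\<in>U. W q = V q) \<longrightarrow> D p v W = D p v V)) \<and>
       (\<forall>X. vector_field M U X \<longrightarrow> section_along M N \<phi> U (\<lambda>p. D p (X p) V)))"

definition levi_civita ::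
    "('m, 'a::euclidean_space) manifold \<Rightarrow> ('m \<Rightarrow> 'm tvec \<Rightarrow> 'm tvec \<Rightarrow> real) \<Rightarrow> ('m, 'm) cov \<Rightarrow> bool" where
  "levi_civita M g D \<longleftrightarrow> connection_along M M id D \<and>
     (\<forall>U X Y. openin (mtop M) U \<and> vector_field M U X \<and> vector_field M U Y \<longrightarrow>
       (\<forall>p\<in>U. D p (X p) Y - D p (Y p) X = lie_bracket M X Y p \<and>
         (\<forall>v\<in>tangent_space M p.
            v (\<lambda>q. g q (X q) (Y q)) = g p (D p v X) (Y p) + g p (X p) (D p v Y))))"

definition pullback_connection ::
    "('m, 'a::euclidean_space) manifold \<Rightarrow> ('n, 'b::euclidean_space) manifold \<Rightarrow> ('m \<Rightarrow> 'n) \<Rightarrow>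
     ('n, 'n) cov \<Rightarrow> ('m, 'n) cov \<Rightarrow> bool" where
  "pullback_connection M N \<phi> DN D \<longleftrightarrow> connection_along M N \<phi> D \<and>
     (\<forall>W Y. openin (mtop N) W \<and> vector_field N W Y \<longrightarrow>
       (\<forall>p\<in>points M. \<forall>v\<in>tangent_space M p. \<phi> p \<in> W \<longrightarrow>
          D p v (\<lambda>q. Y (\<phi> q)) = DN (\<phi> p) (differential N \<phi> p v) Y))"

text \<open>The curvature, first as an operator on vector fields and then as a tensor on \<open>T\<^sub>qN\<close>, evaluated
  through arbitrary local extensions of the three vectors.\<close>

definition curvature_op ::
    "('n, 'b::euclidean_space) manifold \<Rightarrow> ('n, 'n) cov \<Rightarrow>
     ('n \<Rightarrow> 'n tvec) \<Rightarrow> ('n \<Rightarrow> 'n tvec) \<Rightarrow> ('n \<Rightarrow> 'n tvec) \<Rightarrow> 'n \<Rightarrow> 'n tvec" where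
  "curvature_op N DN X Y Z q =
     DN q (X q) (\<lambda>r. DN r (Y r) Z) - DN q (Y q) (\<lambda>r. DN r (X r) Z) - DN q (lie_bracket N X Y q) Z"

definition curvature ::
    "('n, 'b::euclidean_space) manifold \<Rightarrow> ('n, 'n) cov \<Rightarrow>
     'n \<Rightarrow> 'n tvec \<Rightarrow> 'n tvec \<Rightarrow> 'n tvec \<Rightarrow> 'n tvec" where
  "curvature N DN q x y z = (THE w. \<forall>U X Y Z. openin (mtop N) U \<and> q \<in> U \<and>
     vector_field N U X \<and> vector_field N U Y \<and> vector_field N U Z \<and> X q = x \<and> Y q = y \<and> Z q = z
     \<longrightarrow> curvature_op N DN X Y Z q = w)"


section \<open>Traces, tension fields and the Laplacian\<close>

definition local_onf ::
    "('m, 'a::euclidean_space) manifold \<Rightarrow> ('m \<Rightarrow> 'm tvec \<Rightarrow> 'm tvec \<Rightarrow> real) \<Rightarrow> 'm set \<Rightarrow>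
     (nat \<Rightarrow> 'm \<Rightarrow> 'm tvec) \<Rightarrow> bool" where
  "local_onf M g U e \<longleftrightarrow> (\<forall>i<DIM('a). vector_field M U (e i)) \<and>
     (\<forall>q\<in>U. \<forall>i<DIM('a). \<forall>j<DIM('a). g q (e i q) (e j q) = (if i = j then 1 else 0))"

text \<open>\<open>trace_at M g p B\<close> is the sum of \<open>B e\<^sub>i\<close> for a local orthonormal frame \<open>e\<close> around \<open>p\<close>.
  The argument of \<open>B\<close> is the vector field \<open>e\<^sub>i\<close> near \<open>p\<close>, not just its value at \<open>p\<close>. In all uses
  below, \<open>B X\<close> is the value at \<open>p\<close> of a tensor on \<open>(X, X)\<close>, so the sum does not depend on the
  frame chosen.\<close>

definition trace_at ::
    "('m, 'a::euclidean_space) manifold \<Rightarrow> ('m \<Rightarrow> 'm tvec \<Rightarrow> 'm tvec \<Rightarrow> real) \<Rightarrow> 'm \<Rightarrow>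
     (('m \<Rightarrow> 'm tvec) \<Rightarrow> 'c::comm_monoid_add) \<Rightarrow> 'c" where
  "trace_at M g p B =
     (let e = (SOME e. \<exists>U. openin (mtop M) U \<and> p \<in> U \<and> local_onf M g U e)
      in \<Sum>i<DIM('a). B (e i))"

definition grad ::
    "('m, 'a::euclidean_space) manifold \<Rightarrow> ('m \<Rightarrow> 'm tvec \<Rightarrow> 'm tvec \<Rightarrow> real) \<Rightarrow>
     ('m \<Rightarrow> real) \<Rightarrow> 'm \<Rightarrow> 'm tvec" where
  "grad M g f p = (THE v. v \<in> tangent_space M p \<and> (\<forall>w\<in>tangent_space M p. g p v w = w f))"

definition divergence ::
    "('m, 'a::euclidean_space) manifold \<Rightarrow> ('m \<Rightarrow> 'm tvec \<Rightarrow> 'm tvec \<Rightarrow> real) \<Rightarrow> ('m, 'm) cov \<Rightarrow>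
     ('m \<Rightarrow> 'm tvec) \<Rightarrow> 'm \<Rightarrow> real" where
  "divergence M g DM Z p = trace_at M g p (\<lambda>X. g p (DM p (X p) Z) (X p))"

definition laplacian ::
    "('m, 'a::euclidean_space) manifold \<Rightarrow> ('m \<Rightarrow> 'm tvec \<Rightarrow> 'm tvec \<Rightarrow> real) \<Rightarrow> ('m, 'm) cov \<Rightarrow>
     ('m \<Rightarrow> real) \<Rightarrow> 'm \<Rightarrow> real" where
  "laplacian M g DM f = divergence M g DM (grad M g f)"

text \<open>In the following, \<open>DM\<close> and \<open>DN\<close> are the Levi-Civita connections of the domain and of the
  target, and \<open>D\<close> is the pull-back connection.\<close>

definition tension ::
    "('m, 'a::euclidean_space) manifold \<Rightarrow> ('m \<Rightarrow> 'm tvec \<Rightarrow> 'm tvec \<Rightarrow> real) \<Rightarrow> ('m, 'm) cov \<Rightarrow>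
     ('n, 'b::euclidean_space) manifold \<Rightarrow> ('m \<Rightarrow> 'n) \<Rightarrow> ('m, 'n) cov \<Rightarrow> 'm \<Rightarrow> 'n tvec" where
  "tension M g DM N \<phi> D p = trace_at M g p (\<lambda>X.
     D p (X p) (\<lambda>q. differential N \<phi> q (X q)) - differential N \<phi> p (DM p (X p) X))"

definition trace_hess ::
    "('m, 'a::euclidean_space) manifold \<Rightarrow> ('m \<Rightarrow> 'm tvec \<Rightarrow> 'm tvec \<Rightarrow> real) \<Rightarrow> ('m, 'm) cov \<Rightarrow>
     ('m, 'n) cov \<Rightarrow> ('m \<Rightarrow> 'n tvec) \<Rightarrow> 'm \<Rightarrow> 'n tvec" where
  "trace_hess M g DM D V p = trace_at M g p (\<lambda>X.
     D p (X p) (\<lambda>q. D q (X q) V) - D p (DM p (X p) X) V)"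

definition trace_curv ::
    "('m, 'a::euclidean_space) manifold \<Rightarrow> ('m \<Rightarrow> 'm tvec \<Rightarrow> 'm tvec \<Rightarrow> real) \<Rightarrow>
     ('n, 'b::euclidean_space) manifold \<Rightarrow> ('n, 'n) cov \<Rightarrow> ('m \<Rightarrow> 'n) \<Rightarrow>
     ('m \<Rightarrow> 'n tvec) \<Rightarrow> 'm \<Rightarrow> 'n tvec" where
  "trace_curv M g N DN \<phi> V p = trace_at M g p (\<lambda>X.
     curvature N DN (\<phi> p) (V p) (differential N \<phi> p (X p)) (differential N \<phi> p (X p)))"

definition bitension ::
    "('m, 'a::euclidean_space) manifold \<Rightarrow> ('m \<Rightarrow> 'm tvec \<Rightarrow> 'm tvec \<Rightarrow> real) \<Rightarrow> ('m, 'm) cov \<Rightarrow>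
     ('n, 'b::euclidean_space) manifold \<Rightarrow> ('n, 'n) cov \<Rightarrow> ('m \<Rightarrow> 'n) \<Rightarrow> ('m, 'n) cov \<Rightarrow>
     'm \<Rightarrow> 'n tvec" where
  "bitension M g DM N DN \<phi> D p =
     (let \<tau> = tension M g DM N \<phi> D
      in - trace_hess M g DM D \<tau> p - trace_curv M g N DN \<phi> \<tau> p)"

definition f_bitension ::
    "('m, 'a::euclidean_space) manifold \<Rightarrow> ('m \<Rightarrow> 'm tvec \<Rightarrow> 'm tvec \<Rightarrow> real) \<Rightarrow> ('m, 'm) cov \<Rightarrow>
     ('n, 'b::euclidean_space) manifold \<Rightarrow> ('n, 'n) cov \<Rightarrow> ('m \<Rightarrow> 'n) \<Rightarrow> ('m, 'n) cov \<Rightarrow>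
     ('m \<Rightarrow> real) \<Rightarrow> 'm \<Rightarrow> 'n tvec" where
  "f_bitension M g DM N DN \<phi> D f p =
     (let \<tau> = tension M g DM N \<phi> D
      in - trace_hess M g DM D (\<lambda>q. f q \<cdot> \<tau> q) p - f p \<cdot> trace_curv M g N DN \<phi> \<tau> p)"

end

theory Submission
  imports Defs
begin

text \<open>On a neighbourhood with a local orthonormal frame \<open>e\<^sub>i\<close>, two applications of the Leibniz rule give
  \<open>\<nabla>\<^sub>X\<nabla>\<^sub>X(f\<tau>) - \<nabla>\<^bsub>\<nabla>\<^sub>X X\<^esub>(f\<tau>) = f(\<nabla>\<^sub>X\<nabla>\<^sub>X\<tau> - \<nabla>\<^bsub>\<nabla>\<^sub>X X\<^esub>\<tau>) + (X(Xf) - (\<nabla>\<^sub>X X)f)\<tau> + 2(Xf)\<nabla>\<^sub>X\<tau>\<close>.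
  Summing over \<open>X = e\<^sub>i\<close>, the middle terms add up to \<open>(\<Delta>f)\<tau>\<close>, by compatibility of the Levi-Civita
  connection with the metric, and the last ones to \<open>2\<nabla>\<^bsub>grad f\<^esub>\<tau>\<close>, because \<open>grad f = \<Sum>(e\<^sub>i f)e\<^sub>i\<close>. The
  curvature terms are literally equal. The Leibniz rule applies only to smooth sections, and
  smoothness of \<open>\<tau>\<close> rests on the existence of smooth local orthonormal frames and on the independence
  of the trace of the frame.\<close>

section \<open>Calculus of smooth functions on Euclidean space\<close>

text \<open>\<open>trace_at\<close> chooses its frame from \<open>M\<close>, \<open>g\<close> and
  \<open>p\<close> alone, so all traces at one point run over the same frame and can be compared
  summand by summand. A change of frame matters only for \<tau>: the Hessian differentiates it, so
  it must be smooth near \<open>p\<close>, although its values at different points come from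
  unrelated frames. The gradient is differentiated too, but it is characterised pointwise without a
  frame, so its expansion in any one frame shows its smoothness. The other difficulty lies in the
  encoding. A tangent vector is a functional on all functions, set to 0 on those not smooth near the
  point, and charts and sections carry irrelevant values off their domains. Differentiation
  therefore goes together with a locality argument: a function or section is replaced by one that
  agrees with it on an open set. In return, sums and multiples of tangent vectors are pointwise, so
  vector identities can be checked by evaluating both sides at an arbitrary function and doing real
  arithmetic.\<close>

lemma Ck_on_cong:
  assumes "open S" "\<And>x. x \<in> S \<Longrightarrow> F x = G x" "Ck_on k S F"
  shows "Ck_on k S G"
  using assms
proof (induction k arbitrary: F G)
  case 0
  then show ?case by (simp cong: continuous_on_cong)
next
  case (Suc k)
  have d: "F differentiable (at x)" if "x \<in> S" for x
    using Suc.prems that by simp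
  have "G differentiable (at x)" if "x \<in> S" for x
    using d[OF that] Suc.prems(1,2) that
    by (metis differentiable_def has_derivative_transform_within_open)
  moreover have "frechet_derivative F (at x) = frechet_derivative G (at x)" if "x \<in> S" for x
    using frechet_derivative_transform_within_open[OF d[OF that] Suc.prems(1) that Suc.prems(2)] .
  then have "Ck_on k S (\<lambda>x. frechet_derivative G (at x) a)" for a
    using Suc.IH[OF Suc.prems(1), of "\<lambda>x. frechet_derivative F (at x) a"
        "\<lambda>x. frechet_derivative G (at x) a"] Suc.prems(3)
    by simp
  ultimately show ?case by simp
qed

lemma Ck_on_SucD: "Ck_on (Suc k) S F \<Longrightarrow> Ck_on k S F"
proof (induction k arbitrary: F)
  case 0
  then show ?case
    by (auto intro!: continuous_at_imp_continuous_on differentiable_imp_continuous_within)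
next
  case (Suc k)
  have "Ck_on k S (\<lambda>x. frechet_derivative F (at x) a)" for a
    by (rule Suc.IH) (use Suc.prems in simp)
  then show ?case using Suc.prems by simp
qed

text \<open>Each clause of \<open>Ck_on\<close> speaks about single points, and on an open
  neighbourhood continuity on the set is continuity at the point. This is what permits checking
  smoothness in a small chart domain around each point.\<close>

lemma Ck_on_local:
  assumes "\<And>x. x \<in> S \<Longrightarrow> \<exists>T. open T \<and> x \<in> T \<and> Ck_on k T F"
  shows "Ck_on k S F"
  using assms
proof (induction k arbitrary: F)
  case 0
  then show ?case
    by (metis Ck_on.simps(1) continuous_at_imp_continuous_on continuous_on_eq_continuous_at)
next
  case (Suc k)
  have "F differentiable (at x)" if "x \<in> S" for x
    using Suc.prems[OF that] by auto
  moreover have "Ck_on k S (\<lambda>x. frechet_derivative F (at x) a)" for a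
    by (rule Suc.IH) (use Suc.prems in fastforce)
  ultimately show ?case by simp
qed

lemma Ck_on_subset: "Ck_on k S F \<Longrightarrow> T \<subseteq> S \<Longrightarrow> Ck_on k T F"
  by (induction k arbitrary: F) (auto intro: continuous_on_subset)

lemma Ck_on_const: "Ck_on k S (\<lambda>x. c)"
  by (induction k arbitrary: c) (auto simp: frechet_derivative_const)

lemma Ck_on_bounded_linear:
  assumes "bounded_linear F"
  shows "Ck_on k S F"
proof (cases k)
  case 0
  then show ?thesis using assms by (simp add: bounded_linear.linear linear_continuous_on)
next
  case (Suc j)
  have D: "(F has_derivative F) (at x)" for x
    using assms by (rule bounded_linear_imp_has_derivative)
  then have "frechet_derivative F (at x) = F" for x
    by (metis frechet_derivative_at)
  then show ?thesis using Suc D by (auto simp: Ck_on_const differentiable_def)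
qed

lemma Ck_on_add:
  assumes "open S" "Ck_on k S F" "Ck_on k S G"
  shows "Ck_on k S (\<lambda>x. F x + G x)"
  using assms
proof (induction k arbitrary: F G)
  case 0
  then show ?case by (simp add: continuous_on_add)
next
  case (Suc k)
  have d: "F differentiable (at x)" "G differentiable (at x)" if "x \<in> S" for x
    using Suc.prems that by auto
  have "Ck_on k S (\<lambda>x. frechet_derivative (\<lambda>x. F x + G x) (at x) a)" for a
  proof (rule Ck_on_cong[OF Suc.prems(1)])
    show "Ck_on k S (\<lambda>x. frechet_derivative F (at x) a + frechet_derivative G (at x) a)"
      using Suc by simp
  next
    fix x assume "x \<in> S"
    then have "((\<lambda>x. F x + G x) has_derivative
        (\<lambda>a. frechet_derivative F (at x) a + frechet_derivative G (at x) a)) (at x)"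
      using has_derivative_add d unfolding frechet_derivative_works by blast
    then show "frechet_derivative F (at x) a + frechet_derivative G (at x) a
        = frechet_derivative (\<lambda>x. F x + G x) (at x) a"
      by (rule fun_cong[OF frechet_derivative_at])
  qed
  then show ?case using d by simp
qed

lemma Ck_on_sum:
  assumes "open S" "\<And>i. i \<in> I \<Longrightarrow> Ck_on k S (F i)"
  shows "Ck_on k S (\<lambda>x. \<Sum>i\<in>I. F i x)"
  using assms by (induction I rule: infinite_finite_induct) (auto simp: Ck_on_const Ck_on_add)

text \<open>By the product rule the derivative is again a sum of two \<open>B\<close>-products of
  maps of class \<open>k\<close>, so the induction closes. The general \<open>B\<close> covers
  products of reals, scalar multiples and inner products at once.\<close>

lemma Ck_on_bilinear:
  assumes B: "bounded_bilinear B" and "open S" "Ck_on k S F" "Ck_on k S G"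
  shows "Ck_on k S (\<lambda>x. B (F x) (G x))"
  using assms(2-)
proof (induction k arbitrary: F G)
  case 0
  then show ?case using bounded_bilinear.continuous_on[OF B] by simp
next
  case (Suc k)
  have d: "F differentiable (at x)" "G differentiable (at x)" if "x \<in> S" for x
    using Suc.prems that by auto
  have D: "((\<lambda>x. B (F x) (G x)) has_derivative
      (\<lambda>a. B (F x) (frechet_derivative G (at x) a) + B (frechet_derivative F (at x) a) (G x))) (at x)"
    if "x \<in> S" for x
    using bounded_bilinear.FDERIV[OF B] d[OF that] unfolding frechet_derivative_works by blast
  have "Ck_on k S (\<lambda>x. frechet_derivative (\<lambda>x. B (F x) (G x)) (at x) a)" for a
  proof (rule Ck_on_cong[OF Suc.prems(1)])
    show "Ck_on k S (\<lambda>x. B (F x) (frechet_derivative G (at x) a)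
        + B (frechet_derivative F (at x) a) (G x))"
      using Suc by (intro Ck_on_add Suc.IH) (auto dest: Ck_on_SucD simp del: Ck_on.simps(2),
        auto)
  qed (rule fun_cong[OF frechet_derivative_at[OF D]])
  moreover have "(\<lambda>x. B (F x) (G x)) differentiable (at x)" if "x \<in> S" for x
    using D[OF that] by (auto simp: differentiable_def)
  ultimately show ?case by simp
qed

text \<open>The chain rule differentiates \<open>G\<close> in the direction
  \<open>frechet_derivative F (at x) a\<close>, which varies with \<open>x\<close>, whereas
  \<open>Ck_on\<close> controls derivatives in fixed directions only. Expanding that direction in
  \<open>Basis\<close> turns the derivative into a finite sum of products to which the induction
  hypothesis applies.\<close>

lemma Ck_on_compose:
  fixes F :: "'a::euclidean_space \<Rightarrow> 'b::euclidean_space" and G :: "'b \<Rightarrow> 'c::real_normed_vector"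
  assumes "open S" "open T" "F ` S \<subseteq> T" "Ck_on k S F" "Ck_on k T G"
  shows "Ck_on k S (G \<circ> F)"
  using assms(4-)
proof (induction k arbitrary: G)
  case 0
  then show ?case using assms(3) by (simp add: continuous_on_compose continuous_on_subset del: o_apply)
next
  case (Suc k)
  have dF: "F differentiable (at x)" if "x \<in> S" for x
    using Suc.prems that by auto
  have dG: "G differentiable (at (F x))" if "x \<in> S" for x
    using Suc.prems that assms(3) by auto
  have D: "(G \<circ> F has_derivative
      frechet_derivative G (at (F x)) \<circ> frechet_derivative F (at x)) (at x)" if "x \<in> S" for x
    using diff_chain_at[OF dF[OF that, unfolded frechet_derivative_works]
        dG[OF that, unfolded frechet_derivative_works]] .
  have "Ck_on k S (\<lambda>x. frechet_derivative (G \<circ> F) (at x) a)" for a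
  proof (rule Ck_on_cong[OF assms(1)])
    have 1: "Ck_on k S (\<lambda>x. frechet_derivative F (at x) a)" using Suc.prems by simp
    have 2: "Ck_on k S ((\<lambda>y. frechet_derivative G (at y) b) \<circ> F)" for b
      using Suc.prems Suc.IH Ck_on_SucD by (metis Ck_on.simps(2))
    have 3: "Ck_on k S (\<lambda>x. frechet_derivative F (at x) a \<bullet> b)" for b
      by (intro Ck_on_bilinear[OF bounded_bilinear_inner] assms(1) 1 Ck_on_const)
    show "Ck_on k S (\<lambda>x. \<Sum>b\<in>Basis. (frechet_derivative F (at x) a \<bullet> b) *\<^sub>R
        ((\<lambda>y. frechet_derivative G (at y) b) \<circ> F) x)"
      by (intro Ck_on_sum Ck_on_bilinear[OF bounded_bilinear_scaleR] assms(1) 2 3)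
    fix x assume x: "x \<in> S"
    have lin: "linear (frechet_derivative G (at (F x)))"
      by (rule linear_frechet_derivative[OF dG[OF x]])
    have "frechet_derivative (G \<circ> F) (at x) a
        = frechet_derivative G (at (F x)) (frechet_derivative F (at x) a)"
      by (simp add: frechet_derivative_at[OF D[OF x], symmetric])
    also have "\<dots> = frechet_derivative G (at (F x))
        (\<Sum>b\<in>Basis. (frechet_derivative F (at x) a \<bullet> b) *\<^sub>R b)"
      by (simp add: euclidean_representation)
    also have "\<dots> = (\<Sum>b\<in>Basis. (frechet_derivative F (at x) a \<bullet> b) *\<^sub>R
        ((\<lambda>y. frechet_derivative G (at y) b) \<circ> F) x)"
      by (simp add: linear_sum[OF lin] linear_scale[OF lin])
    finally show "(\<Sum>b\<in>Basis. (frechet_derivative F (at x) a \<bullet> b) *\<^sub>R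
        ((\<lambda>y. frechet_derivative G (at y) b) \<circ> F) x) = frechet_derivative (G \<circ> F) (at x) a" ..
  qed
  moreover have "(G \<circ> F) differentiable (at x)" if "x \<in> S" for x
    using D[OF that] by (auto simp: differentiable_def)
  ultimately show ?case by (simp add: comp_def)
qed

text \<open>The factor \<open>c\<close> and the exponent \<open>r\<close> are both arbitrary because
  differentiation changes both, but stays inside this family.\<close>

lemma Ck_on_powr: "Ck_on k {0<..} (\<lambda>x::real. c * x powr r)"
proof (induction k arbitrary: c r)
  case 0
  then show ?case by (auto intro!: continuous_intros)
next
  case (Suc k)
  have D: "((\<lambda>x. c * x powr r) has_derivative (\<lambda>a. a * (c * (r * x powr (r - 1))))) (at x)"
    if "x > 0" for x
  proof -
    have "((\<lambda>x. c * x powr r) has_real_derivative c * (r * x powr (r - 1))) (at x)"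
      using that by (auto intro!: derivative_eq_intros DERIV_powr simp: powr_diff)
    then show ?thesis by (simp add: has_field_derivative_def mult_commute_abs)
  qed
  have "Ck_on k {0<..} (\<lambda>x. frechet_derivative (\<lambda>x. c * x powr r) (at x) a)" for a
  proof (rule Ck_on_cong)
    show "Ck_on k {0<..} (\<lambda>x. (a * c * r) * x powr (r - 1))" by (rule Suc.IH)
    fix x :: real assume "x \<in> {0<..}"
    then show "(a * c * r) * x powr (r - 1) = frechet_derivative (\<lambda>x. c * x powr r) (at x) a"
      by (simp add: frechet_derivative_at[OF D, symmetric] mult.assoc)
  qed simp
  then show ?case using D by (auto simp: differentiable_def)
qed

lemma smooth_on_cong:
  "open S \<Longrightarrow> (\<And>x. x \<in> S \<Longrightarrow> F x = G x) \<Longrightarrow> smooth_on S F \<Longrightarrow> smooth_on S G"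
  unfolding smooth_on_def using Ck_on_cong by blast

lemma smooth_on_subset: "smooth_on S F \<Longrightarrow> T \<subseteq> S \<Longrightarrow> smooth_on T F"
  unfolding smooth_on_def using Ck_on_subset by blast

lemma smooth_on_local:
  assumes "\<And>x. x \<in> S \<Longrightarrow> \<exists>T. open T \<and> x \<in> T \<and> smooth_on T F"
  shows "smooth_on S F"
  unfolding smooth_on_def using assms by (metis Ck_on_local smooth_on_def)

lemma smooth_on_const: "smooth_on S (\<lambda>x. c)"
  by (simp add: smooth_on_def Ck_on_const)

lemma smooth_on_bounded_linear: "bounded_linear F \<Longrightarrow> smooth_on S F"
  by (simp add: smooth_on_def Ck_on_bounded_linear)

lemma smooth_on_add:
  "open S \<Longrightarrow> smooth_on S F \<Longrightarrow> smooth_on S G \<Longrightarrow> smooth_on S (\<lambda>x. F x + G x)"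
  by (simp add: smooth_on_def Ck_on_add)

lemma smooth_on_mult:
  fixes F G :: "'a::euclidean_space \<Rightarrow> real"
  shows "open S \<Longrightarrow> smooth_on S F \<Longrightarrow> smooth_on S G \<Longrightarrow> smooth_on S (\<lambda>x. F x * G x)"
  by (simp add: smooth_on_def Ck_on_bilinear[OF bounded_bilinear_mult])

lemma smooth_on_compose:
  fixes F :: "'a::euclidean_space \<Rightarrow> 'b::euclidean_space" and G :: "'b \<Rightarrow> 'c::real_normed_vector"
  shows "open S \<Longrightarrow> open T \<Longrightarrow> F ` S \<subseteq> T \<Longrightarrow> smooth_on S F \<Longrightarrow> smooth_on T G
    \<Longrightarrow> smooth_on S (G \<circ> F)"
  by (simp add: smooth_on_def Ck_on_compose)

lemma smooth_on_powr: "smooth_on {0<..} (\<lambda>x::real. x powr r)"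
  using Ck_on_powr[of _ 1 r] by (simp add: smooth_on_def)

lemma smooth_on_differentiable: "smooth_on S F \<Longrightarrow> x \<in> S \<Longrightarrow> F differentiable (at x)"
  unfolding smooth_on_def by (metis Ck_on.simps(2))

lemma smooth_on_frechet_derivative:
  "smooth_on S F \<Longrightarrow> smooth_on S (\<lambda>x. frechet_derivative F (at x) a)"
  unfolding smooth_on_def by (metis Ck_on.simps(2))

section \<open>Charts and tangent spaces\<close>

lemma chartD:
  assumes "smooth_manifold M" "(U, \<psi>) \<in> charts M"
  shows "openin (mtop M) U" "U \<subseteq> points M" "inj_on \<psi> U"
    and "homeomorphic_map (subtopology (mtop M) U) (top_of_set (\<psi> ` U)) \<psi>"
    and "open (\<psi> ` U)"
proof -
  show U: "openin (mtop M) U" and h: "homeomorphic_map (subtopology (mtop M) U) (top_of_set (\<psi> ` U)) \<psi>"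
    and "open (\<psi> ` U)"
    using assms unfolding smooth_manifold_def by auto
  show sub: "U \<subseteq> points M" using U by (rule openin_subset)
  show "inj_on \<psi> U"
    using homeomorphic_imp_injective_map[OF h] sub by (simp add: Int_absorb1)
qed

lemma chart_image_open:
  assumes "smooth_manifold M" "(U, \<psi>) \<in> charts M" "openin (mtop M) W"
  shows "open (\<psi> ` (U \<inter> W))"
proof -
  have "openin (subtopology (mtop M) U) (U \<inter> W)"
    using assms(3) by (auto simp: openin_subtopology)
  then have "openin (top_of_set (\<psi> ` U)) (\<psi> ` (U \<inter> W))"
    using homeomorphic_imp_open_map[OF chartD(4)[OF assms(1,2)]] by (simp add: open_map_def)
  then show ?thesis
    using chartD(5)[OF assms(1,2)] openin_open_trans by blast
qed

lemma chart_exists: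
  assumes "smooth_manifold M" "p \<in> points M"
  obtains U \<psi> where "(U, \<psi>) \<in> charts M" "p \<in> U"
  using assms unfolding smooth_manifold_def by blast

lemma smooth_transition:
  assumes "smooth_manifold M" "(U, \<psi>) \<in> charts M" "(U', \<psi>') \<in> charts M"
  shows "smooth_on (\<psi> ` (U \<inter> U')) (\<psi>' \<circ> inv_into U \<psi>)"
  using assms unfolding smooth_manifold_def by blast

section \<open>Smooth real functions on a manifold\<close>

lemma smooth_funD:
  "smooth_fun M W u \<Longrightarrow> (U, \<psi>) \<in> charts M \<Longrightarrow> smooth_on (\<psi> ` (U \<inter> W)) (u \<circ> inv_into U \<psi>)"
  unfolding smooth_fun_def by blast

lemma smooth_funI:
  "(\<And>U \<psi>. (U, \<psi>) \<in> charts M \<Longrightarrow> smooth_on (\<psi> ` (U \<inter> W)) (u \<circ> inv_into U \<psi>)) \<Longrightarrow> smooth_fun M W u"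
  unfolding smooth_fun_def by blast

lemma smooth_fun_subset: "smooth_fun M W u \<Longrightarrow> W' \<subseteq> W \<Longrightarrow> smooth_fun M W' u"
  unfolding smooth_fun_def by (blast intro: smooth_on_subset)

lemma smooth_fun_cong:
  assumes "smooth_manifold M" "openin (mtop M) W" "\<And>p. p \<in> W \<Longrightarrow> u p = u' p" "smooth_fun M W u"
  shows "smooth_fun M W u'"
proof (rule smooth_funI)
  fix U \<psi> assume c: "(U, \<psi>) \<in> charts M"
  show "smooth_on (\<psi> ` (U \<inter> W)) (u' \<circ> inv_into U \<psi>)"
    by (rule smooth_on_cong[OF chart_image_open[OF assms(1) c assms(2)] _ smooth_funD[OF assms(4) c]])
      (auto simp: assms(3) inv_into_f_f[OF chartD(3)[OF assms(1) c]])
qed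

lemma smooth_fun_const: "smooth_fun M W (\<lambda>p. c)"
  by (simp add: smooth_fun_def comp_def smooth_on_const case_prod_unfold)

lemma smooth_fun_add:
  assumes "smooth_manifold M" "openin (mtop M) W" "smooth_fun M W u" "smooth_fun M W u'"
  shows "smooth_fun M W (\<lambda>p. u p + u' p)"
  using smooth_on_add[OF chart_image_open[OF assms(1) _ assms(2)] smooth_funD[OF assms(3)]
      smooth_funD[OF assms(4)]]
  by (intro smooth_funI) (simp add: comp_def)

lemma smooth_fun_mult:
  assumes "smooth_manifold M" "openin (mtop M) W" "smooth_fun M W u" "smooth_fun M W u'"
  shows "smooth_fun M W (\<lambda>p. u p * u' p)"
  using smooth_on_mult[OF chart_image_open[OF assms(1) _ assms(2)] smooth_funD[OF assms(3)]
      smooth_funD[OF assms(4)]]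
  by (intro smooth_funI) (simp add: comp_def)

lemma smooth_fun_powr:
  assumes "smooth_manifold M" "openin (mtop M) W" "smooth_fun M W u" "\<And>p. p \<in> W \<Longrightarrow> u p > 0"
  shows "smooth_fun M W (\<lambda>p. u p powr r)"
proof (rule smooth_funI)
  fix U \<psi> assume c: "(U, \<psi>) \<in> charts M"
  have "(u \<circ> inv_into U \<psi>) ` (\<psi> ` (U \<inter> W)) \<subseteq> {0<..}"
    using assms(4) by (auto simp: inv_into_f_f[OF chartD(3)[OF assms(1) c]])
  from smooth_on_compose[OF chart_image_open[OF assms(1) c assms(2)] _ this
      smooth_funD[OF assms(3) c] smooth_on_powr]
  show "smooth_on (\<psi> ` (U \<inter> W)) ((\<lambda>p. u p powr r) \<circ> inv_into U \<psi>)"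
    by (simp add: comp_def)
qed

lemma smooth_fun_local:
  assumes "smooth_manifold M"
    and "\<And>p. p \<in> W \<Longrightarrow> \<exists>W'. openin (mtop M) W' \<and> p \<in> W' \<and> smooth_fun M W' u"
  shows "smooth_fun M W u"
proof (intro smooth_funI smooth_on_local)
  fix U \<psi> x assume c: "(U, \<psi>) \<in> charts M" and "x \<in> \<psi> ` (U \<inter> W)"
  then obtain p where p: "p \<in> U" "p \<in> W" "x = \<psi> p" by auto
  obtain W' where W': "openin (mtop M) W'" "p \<in> W'" "smooth_fun M W' u"
    using assms(2)[OF p(2)] by auto
  show "\<exists>T. open T \<and> x \<in> T \<and> smooth_on T (u \<circ> inv_into U \<psi>)"
    using chart_image_open[OF assms(1) c W'(1)] p W' smooth_funD[OF W'(3) c] by blast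
qed

text \<open>One chart suffices: in any other chart the function is its expression in the first one
  composed with a transition map, which is smooth by the compatibility of the atlas.\<close>

lemma smooth_fun_chartI:
  assumes M: "smooth_manifold M" and c: "(U, \<psi>) \<in> charts M" and W: "openin (mtop M) W" "W \<subseteq> U"
    and u: "smooth_on (\<psi> ` W) (u \<circ> inv_into U \<psi>)"
  shows "smooth_fun M W u"
proof (rule smooth_funI)
  fix U' \<psi>' assume c': "(U', \<psi>') \<in> charts M"
  note inv = inv_into_f_f[OF chartD(3)[OF M c]] inv_into_f_f[OF chartD(3)[OF M c']]
  note op = chart_image_open[OF M c' W(1)]
  have "open (\<psi> ` W)"
    using chart_image_open[OF M c W(1)] W(2) by (simp add: Int_absorb1)
  moreover have "(\<psi> \<circ> inv_into U' \<psi>') ` (\<psi>' ` (U' \<inter> W)) \<subseteq> \<psi> ` W"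
    by (auto simp: inv)
  moreover have "smooth_on (\<psi>' ` (U' \<inter> W)) (\<psi> \<circ> inv_into U' \<psi>')"
    using W(2) by (intro smooth_on_subset[OF smooth_transition[OF M c' c]]) auto
  ultimately have "smooth_on (\<psi>' ` (U' \<inter> W)) ((u \<circ> inv_into U \<psi>) \<circ> (\<psi> \<circ> inv_into U' \<psi>'))"
    using smooth_on_compose[OF op _ _ _ u] by blast
  then show "smooth_on (\<psi>' ` (U' \<inter> W)) (u \<circ> inv_into U' \<psi>')"
    by (rule smooth_on_cong[OF op, rotated]) (use W(2) in \<open>auto simp: inv subsetD\<close>)
qed

lemma smooth_near_cong:
  assumes M: "smooth_manifold M" and W: "openin (mtop M) W" "p \<in> W" "\<And>q. q \<in> W \<Longrightarrow> u q = u' q"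
    and u: "smooth_near M p u"
  shows "smooth_near M p u'"
proof -
  obtain W' where W': "openin (mtop M) W'" "p \<in> W'" "smooth_fun M W' u"
    using u unfolding smooth_near_def by auto
  have "smooth_fun M (W \<inter> W') u'"
    by (rule smooth_fun_cong[OF M _ _ smooth_fun_subset[OF W'(3)]]) (use W W' in auto)
  then show ?thesis using W W' unfolding smooth_near_def by blast
qed

lemma smooth_near_differentiable:
  assumes "smooth_manifold M" "(U, \<psi>) \<in> charts M" "p \<in> U" "smooth_near M p u"
  shows "(u \<circ> inv_into U \<psi>) differentiable (at (\<psi> p))"
  using assms smooth_funD smooth_on_differentiable unfolding smooth_near_def
  by (metis (no_types, lifting) Int_iff image_eqI)

text \<open>Being smooth near \<open>p\<close> is itself a local property, so either both functions
  are differentiated or both get the default value 0.\<close>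

lemma coord_vec_local:
  assumes M: "smooth_manifold M" and c: "(U, \<psi>) \<in> charts M" "p \<in> U"
    and W: "openin (mtop M) W" "p \<in> W" "\<And>q. q \<in> W \<Longrightarrow> u q = u' q"
  shows "coord_vec M (U, \<psi>) p a u = coord_vec M (U, \<psi>) p a u'"
proof (cases "smooth_near M p u")
  case True
  have "frechet_derivative (u \<circ> inv_into U \<psi>) (at (\<psi> p)) =
      frechet_derivative (u' \<circ> inv_into U \<psi>) (at (\<psi> p))"
    by (rule frechet_derivative_transform_within_open[OF smooth_near_differentiable[OF M c True]
          chart_image_open[OF M c(1) W(1)]])
      (use c W in \<open>auto simp: inv_into_f_f[OF chartD(3)[OF M c(1)]]\<close>)
  then show ?thesis
    using True smooth_near_cong[OF M W True] by (simp add: coord_vec_def)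
next
  case False
  then have "\<not> smooth_near M p u'"
    using smooth_near_cong[OF M W(1,2), of u' u] W(3) by auto
  then show ?thesis using False by (simp add: coord_vec_def)
qed

lemma coord_vec_add:
  assumes "smooth_manifold M" "(U, \<psi>) \<in> charts M" "p \<in> U"
  shows "coord_vec M (U, \<psi>) p (a + b) = coord_vec M (U, \<psi>) p a + coord_vec M (U, \<psi>) p b"
  using linear_add[OF linear_frechet_derivative[OF smooth_near_differentiable[OF assms]]]
  by (auto simp: coord_vec_def fun_eq_iff)

lemma coord_vec_scale:
  assumes "smooth_manifold M" "(U, \<psi>) \<in> charts M" "p \<in> U"
  shows "coord_vec M (U, \<psi>) p (r *\<^sub>R a) = r \<cdot> coord_vec M (U, \<psi>) p a"
  using linear_scale[OF linear_frechet_derivative[OF smooth_near_differentiable[OF assms]]]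
  by (auto simp: coord_vec_def tscale_def fun_eq_iff)

text \<open>The coordinate functions of a chart are smooth on its domain, so the default value does
  not interfere, and they read off the components of a coordinate vector. Hence different directions
  give different vectors.\<close>

lemma coord_vec_coordinate:
  assumes M: "smooth_manifold M" and c: "(U, \<psi>) \<in> charts M" "p \<in> U"
  shows "coord_vec M (U, \<psi>) p a (\<lambda>q. \<psi> q \<bullet> b) = a \<bullet> b"
proof -
  note inv = inv_into_f_f[OF chartD(3)[OF M c(1)]]
  have bl: "bounded_linear (\<lambda>x. x \<bullet> b)" by (rule bounded_linear_inner_left)
  have U: "openin (mtop M) U" "open (\<psi> ` U)" using chartD[OF M c(1)] by auto
  have "smooth_on (\<psi> ` U) ((\<lambda>q. \<psi> q \<bullet> b) \<circ> inv_into U \<psi>)"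
    by (rule smooth_on_cong[OF U(2) _ smooth_on_bounded_linear[OF bl]]) (auto simp: inv)
  then have "smooth_near M p (\<lambda>q. \<psi> q \<bullet> b)"
    using smooth_fun_chartI[OF M c(1) U(1)] U c(2) unfolding smooth_near_def by blast
  moreover have "frechet_derivative (\<lambda>x. x \<bullet> b) (at (\<psi> p)) =
      frechet_derivative ((\<lambda>q. \<psi> q \<bullet> b) \<circ> inv_into U \<psi>) (at (\<psi> p))"
    by (rule frechet_derivative_transform_within_open[OF bounded_linear_imp_differentiable[OF bl] U(2)])
      (use c in \<open>auto simp: inv\<close>)
  moreover have "frechet_derivative (\<lambda>x. x \<bullet> b) (at (\<psi> p)) = (\<lambda>x. x \<bullet> b)"
    using frechet_derivative_at[OF bounded_linear_imp_has_derivative[OF bl]] by metis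
  ultimately show ?thesis
    by (simp add: coord_vec_def) metis
qed

text \<open>Testing on the coordinate function in the direction \<open>a\<close> itself yields
  \<open>a \<bullet> a = 0\<close>.\<close>

lemma coord_vec_eq_0:
  assumes "smooth_manifold M" "(U, \<psi>) \<in> charts M" "p \<in> U" "coord_vec M (U, \<psi>) p a = 0"
  shows "a = 0"
  using coord_vec_coordinate[OF assms(1-3), of a a] assms(4) by simp

section \<open>Smooth maps and their differentials\<close>

lemma smooth_map_id:
  assumes "smooth_manifold M"
  shows "smooth_map M M id"
  using smooth_transition[OF assms] unfolding smooth_map_def by (auto simp: vimage_def)

lemma smooth_map_preimage:
  assumes "smooth_map M N \<phi>" "openin (mtop M) U" "openin (mtop N) W"
  shows "openin (mtop M) (U \<inter> \<phi> -` W)"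
proof -
  have "openin (mtop M) {p \<in> points M. \<phi> p \<in> W}"
    using assms unfolding smooth_map_def by (blast intro: openin_continuous_map_preimage)
  moreover have "U \<inter> \<phi> -` W = U \<inter> {p \<in> points M. \<phi> p \<in> W}"
    using openin_subset[OF assms(2)] by auto
  ultimately show ?thesis using assms(2) by (metis openin_Int)
qed

lemma smooth_map_point: "smooth_map M N \<phi> \<Longrightarrow> p \<in> points M \<Longrightarrow> \<phi> p \<in> points N"
  unfolding smooth_map_def continuous_map_def by blast

lemma smooth_mapD:
  "smooth_map M N \<phi> \<Longrightarrow> (U, \<psi>) \<in> charts M \<Longrightarrow> (U', \<eta>) \<in> charts N
    \<Longrightarrow> smooth_on (\<psi> ` (U \<inter> \<phi> -` U')) (\<eta> \<circ> \<phi> \<circ> inv_into U \<psi>)"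
  unfolding smooth_map_def by blast

text \<open>Near each point the composite factors through a chart of \<open>N\<close> into two maps
  between Euclidean open sets. The intersection with \<open>points M\<close> discards the part of
  the preimage outside the manifold, where \<phi> is arbitrary.\<close>

lemma smooth_fun_pullback:
  assumes M: "smooth_manifold M" and N: "smooth_manifold N" and \<phi>: "smooth_map M N \<phi>"
    and W: "openin (mtop N) W" and u: "smooth_fun N W u"
  shows "smooth_fun M (points M \<inter> \<phi> -` W) (u \<circ> \<phi>)"
proof (rule smooth_fun_local[OF M])
  fix p assume p: "p \<in> points M \<inter> \<phi> -` W"
  obtain U \<psi> where c: "(U, \<psi>) \<in> charts M" "p \<in> U" using chart_exists[OF M] p by blast
  obtain U' \<eta> where d: "(U', \<eta>) \<in> charts N" "\<phi> p \<in> U'"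
    using chart_exists[OF N] smooth_map_point[OF \<phi>] p by blast
  note inv = inv_into_f_f[OF chartD(3)[OF M c(1)]] inv_into_f_f[OF chartD(3)[OF N d(1)]]
  have U'W: "openin (mtop N) (U' \<inter> W)" using chartD(1)[OF N d(1)] W by blast
  let ?W = "U \<inter> \<phi> -` (U' \<inter> W)"
  have W': "openin (mtop M) ?W"
    by (rule smooth_map_preimage[OF \<phi> chartD(1)[OF M c(1)] U'W])
  have op: "open (\<psi> ` ?W)"
    using chart_image_open[OF M c(1) W'] by (simp add: Int_absorb1 Int_assoc[symmetric])
  have "smooth_on (\<psi> ` ?W) ((u \<circ> inv_into U' \<eta>) \<circ> (\<eta> \<circ> \<phi> \<circ> inv_into U \<psi>))"
  proof (rule smooth_on_compose[OF op chart_image_open[OF N d(1) W] _ _ smooth_funD[OF u d(1)]])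
    show "smooth_on (\<psi> ` ?W) (\<eta> \<circ> \<phi> \<circ> inv_into U \<psi>)"
      by (rule smooth_on_subset[OF smooth_mapD[OF \<phi> c(1) d(1)]]) auto
  qed (auto simp: inv)
  then have "smooth_on (\<psi> ` ?W) (u \<circ> \<phi> \<circ> inv_into U \<psi>)"
    by (rule smooth_on_cong[OF op, rotated]) (auto simp: inv)
  then have "smooth_fun M ?W (u \<circ> \<phi>)"
    by (intro smooth_fun_chartI[OF M c(1) W']) auto
  then show "\<exists>W'. openin (mtop M) W' \<and> p \<in> W' \<and> smooth_fun M W' (u \<circ> \<phi>)"
    using W' c d p by blast
qed

text \<open>The chain rule: in charts, the differential is the Jacobian. For the identity map this
  is the transformation rule between two charts.\<close>

lemma differential_coord_vec:
  assumes M: "smooth_manifold M" and N: "smooth_manifold N" and \<phi>: "smooth_map M N \<phi>"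
    and c: "(U, \<psi>) \<in> charts M" "p \<in> U" and d: "(U', \<eta>) \<in> charts N" "\<phi> p \<in> U'"
  shows "differential N \<phi> p (coord_vec M (U, \<psi>) p a) =
    coord_vec N (U', \<eta>) (\<phi> p) (frechet_derivative (\<eta> \<circ> \<phi> \<circ> inv_into U \<psi>) (at (\<psi> p)) a)"
proof
  fix u :: "'c \<Rightarrow> real"
  note inv = inv_into_f_f[OF chartD(3)[OF M c(1)]] inv_into_f_f[OF chartD(3)[OF N d(1)]]
  let ?F = "\<eta> \<circ> \<phi> \<circ> inv_into U \<psi>" and ?G = "u \<circ> inv_into U' \<eta>"
  show "differential N \<phi> p (coord_vec M (U, \<psi>) p a) u =
    coord_vec N (U', \<eta>) (\<phi> p) (frechet_derivative ?F (at (\<psi> p)) a) u"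
  proof (cases "smooth_near N (\<phi> p) u")
    case True
    then obtain W where W: "openin (mtop N) W" "\<phi> p \<in> W" "smooth_fun N W u"
      unfolding smooth_near_def by auto
    have p: "p \<in> points M" using chartD(2)[OF M c(1)] c(2) by auto
    \<comment> \<open>This excludes the default branch of \<open>coord_vec\<close> on the
      \<open>M\<close> side.\<close>
    have near: "smooth_near M p (u \<circ> \<phi>)"
      unfolding smooth_near_def
      using smooth_fun_pullback[OF M N \<phi> W(1,3)] smooth_map_preimage[OF \<phi> openin_topspace W(1)] W p
      by blast
    have op: "open (\<psi> ` (U \<inter> \<phi> -` U'))"
      using chart_image_open[OF M c(1) smooth_map_preimage[OF \<phi> chartD(1)[OF M c(1)]
            chartD(1)[OF N d(1)]]] by simp
    have px: "\<psi> p \<in> \<psi> ` (U \<inter> \<phi> -` U')" using c d by auto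
    have "?F differentiable (at (\<psi> p))"
      by (rule smooth_on_differentiable[OF smooth_mapD[OF \<phi> c(1) d(1)] px])
    moreover have "?G differentiable (at (?F (\<psi> p)))"
      using smooth_near_differentiable[OF N d True] c by (simp add: inv)
    ultimately have "(?G \<circ> ?F has_derivative
        frechet_derivative ?G (at (?F (\<psi> p))) \<circ> frechet_derivative ?F (at (\<psi> p))) (at (\<psi> p))"
      unfolding frechet_derivative_works by (rule diff_chain_at)
    moreover have "?F (\<psi> p) = \<eta> (\<phi> p)" using c by (simp add: inv)
    ultimately have "(?G \<circ> ?F has_derivative
        frechet_derivative ?G (at (\<eta> (\<phi> p))) \<circ> frechet_derivative ?F (at (\<psi> p))) (at (\<psi> p))"
      by (simp only:)
    then have "(u \<circ> \<phi> \<circ> inv_into U \<psi> has_derivative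
        frechet_derivative ?G (at (\<eta> (\<phi> p))) \<circ> frechet_derivative ?F (at (\<psi> p))) (at (\<psi> p))"
      by (rule has_derivative_transform_within_open[OF _ op px]) (auto simp: inv)
    from frechet_derivative_at[OF this] show ?thesis
      using True near by (simp add: differential_def coord_vec_def fun_eq_iff)
  qed (simp add: differential_def coord_vec_def)
qed

lemma differential_tangent:
  assumes "smooth_manifold M" "smooth_manifold N" "smooth_map M N \<phi>"
    and "p \<in> points M" "v \<in> tangent_space M p"
  shows "differential N \<phi> p v \<in> tangent_space N (\<phi> p)"
proof -
  obtain U \<psi> a where c: "(U, \<psi>) \<in> charts M" "p \<in> U" "v = coord_vec M (U, \<psi>) p a"
    using assms(5) unfolding tangent_space_def by auto
  obtain U' \<eta> where d: "(U', \<eta>) \<in> charts N" "\<phi> p \<in> U'"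
    using chart_exists[OF assms(2)] smooth_map_point[OF assms(3,4)] by blast
  show ?thesis
    using differential_coord_vec[OF assms(1-3) c(1,2) d] c d unfolding tangent_space_def by auto
qed

text \<open>\<open>tangent_space\<close> collects the coordinate vectors of all charts around
  \<open>p\<close>; the transformation rule brings each of them into the given chart. Linear algebra
  at \<open>p\<close> can then be done in the model space.\<close>

lemma tangent_space_chart:
  assumes "smooth_manifold M" "(U, \<psi>) \<in> charts M" "p \<in> U"
  shows "tangent_space M p = range (coord_vec M (U, \<psi>) p)"
proof -
  have "coord_vec M (U', \<psi>') p a \<in> range (coord_vec M (U, \<psi>) p)"
    if "(U', \<psi>') \<in> charts M" "p \<in> U'" for U' \<psi>' a
  proof -
    \<comment> \<open>The cutoff in \<open>differential\<close> repeats the one already built into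
      \<open>coord_vec\<close>.\<close>
    have "differential M id p (coord_vec M (U', \<psi>') p a) = coord_vec M (U', \<psi>') p a"
      by (auto simp: differential_def coord_vec_def fun_eq_iff)
    then show ?thesis
      using differential_coord_vec[OF assms(1,1) smooth_map_id[OF assms(1)] that, of U \<psi> a] assms
      by (metis id_apply rangeI)
  qed
  then show ?thesis using assms unfolding tangent_space_def by auto
qed

lemma tangent_space_points:
  assumes "smooth_manifold M" "v \<in> tangent_space M p"
  shows "p \<in> points M"
  using assms chartD(2)[OF assms(1)] unfolding tangent_space_def by force

lemma tangent_local:
  assumes "smooth_manifold M" "v \<in> tangent_space M p"
    and "openin (mtop M) W" "p \<in> W" "\<And>q. q \<in> W \<Longrightarrow> u q = u' q"
  shows "v u = v u'"
  using assms coord_vec_local[OF assms(1) _ _ assms(3-5)] unfolding tangent_space_def by auto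

lemma tangent_add:
  assumes "smooth_manifold M" "v \<in> tangent_space M p" "w \<in> tangent_space M p"
  shows "v + w \<in> tangent_space M p"
proof -
  obtain U \<psi> where c: "(U, \<psi>) \<in> charts M" "p \<in> U"
    using chart_exists[OF assms(1) tangent_space_points[OF assms(1,2)]] by blast
  show ?thesis
    using assms(2,3) coord_vec_add[OF assms(1) c] unfolding tangent_space_chart[OF assms(1) c]
    by (auto, metis rangeI)
qed

lemma tangent_scale:
  assumes "smooth_manifold M" "v \<in> tangent_space M p"
  shows "r \<cdot> v \<in> tangent_space M p"
proof -
  obtain U \<psi> where c: "(U, \<psi>) \<in> charts M" "p \<in> U"
    using chart_exists[OF assms(1) tangent_space_points[OF assms]] by blast
  show ?thesis
    using assms(2) coord_vec_scale[OF assms(1) c] unfolding tangent_space_chart[OF assms(1) c]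
    by (auto, metis rangeI)
qed

lemma tangent_zero:
  assumes "smooth_manifold M" "p \<in> points M"
  shows "0 \<in> tangent_space M p"
proof -
  obtain U \<psi> where c: "(U, \<psi>) \<in> charts M" "p \<in> U"
    using chart_exists[OF assms] by blast
  have "0 \<cdot> coord_vec M (U, \<psi>) p 0 = 0" by (simp add: tscale_def fun_eq_iff)
  then show ?thesis
    using tangent_scale[OF assms(1), of "coord_vec M (U, \<psi>) p 0" p 0] c
    unfolding tangent_space_chart[OF assms(1) c] by auto
qed

lemma tangent_sum:
  assumes "smooth_manifold M" "p \<in> points M" "\<And>i. i \<in> I \<Longrightarrow> v i \<in> tangent_space M p"
  shows "(\<Sum>i\<in>I. v i) \<in> tangent_space M p"
  using assms by (induction I rule: infinite_finite_induct) (auto intro: tangent_zero tangent_add)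

text \<open>Lets the rules for differences follow from those for sums and multiples.\<close>

lemma diff_eq_tscale: "v - w = v + (- 1) \<cdot> w"
  by (simp add: tscale_def fun_eq_iff)

lemma tangent_diff:
  assumes "smooth_manifold M" "v \<in> tangent_space M p" "w \<in> tangent_space M p"
  shows "v - w \<in> tangent_space M p"
  unfolding diff_eq_tscale using assms by (intro tangent_add tangent_scale)

section \<open>Sections along a map\<close>

lemma section_tangent: "section_along M N \<phi> U V \<Longrightarrow> p \<in> U \<Longrightarrow> V p \<in> tangent_space N (\<phi> p)"
  unfolding section_along_def by blast

lemma section_smooth:
  "section_along M N \<phi> U V \<Longrightarrow> openin (mtop N) W \<Longrightarrow> smooth_fun N W u
    \<Longrightarrow> smooth_fun M (U \<inter> \<phi> -` W) (\<lambda>p. V p u)"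
  unfolding section_along_def by blast

lemma sectionI:
  assumes "\<And>p. p \<in> U \<Longrightarrow> V p \<in> tangent_space N (\<phi> p)"
    and "\<And>W u. openin (mtop N) W \<Longrightarrow> smooth_fun N W u \<Longrightarrow> smooth_fun M (U \<inter> \<phi> -` W) (\<lambda>p. V p u)"
  shows "section_along M N \<phi> U V"
  using assms unfolding section_along_def by blast

lemma section_subset: "section_along M N \<phi> U V \<Longrightarrow> U' \<subseteq> U \<Longrightarrow> section_along M N \<phi> U' V"
  unfolding section_along_def
  by (meson Int_mono order_refl smooth_fun_subset subsetD)

lemma vector_field_apply:
  assumes "vector_field M U X" "openin (mtop M) U" "smooth_fun M U u"
  shows "smooth_fun M U (\<lambda>p. X p u)"
  using section_smooth[OF assms] by simp

text \<open>In the chart, applying the field to \<open>u\<close> is differentiating the expression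
  of \<open>u\<close> in the fixed direction \<open>a\<close>, which preserves smoothness.\<close>

lemma vector_field_coord:
  assumes M: "smooth_manifold M" and c: "(U, \<psi>) \<in> charts M"
  shows "vector_field M U (\<lambda>p. coord_vec M (U, \<psi>) p a)"
proof (rule sectionI)
  fix W u assume W: "openin (mtop M) W" and u: "smooth_fun M W u"
  note inv = inv_into_f_f[OF chartD(3)[OF M c]]
  have UW: "openin (mtop M) (U \<inter> W)" using chartD(1)[OF M c] W by blast
  have "smooth_on (\<psi> ` (U \<inter> W)) (\<lambda>x. frechet_derivative (u \<circ> inv_into U \<psi>) (at x) a)"
    by (rule smooth_on_frechet_derivative[OF smooth_funD[OF u c]])
  then have "smooth_on (\<psi> ` (U \<inter> W)) ((\<lambda>p. coord_vec M (U, \<psi>) p a u) \<circ> inv_into U \<psi>)"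
    by (rule smooth_on_cong[OF chart_image_open[OF M c W], rotated])
      (use W u in \<open>auto simp: inv coord_vec_def smooth_near_def\<close>)
  then show "smooth_fun M (U \<inter> id -` W) (\<lambda>p. coord_vec M (U, \<psi>) p a u)"
    using smooth_fun_chartI[OF M c UW] by simp
qed (use c in \<open>auto simp: tangent_space_def\<close>)

section \<open>Closure properties of smooth sections along a map\<close>

context
  fixes M :: "('m, 'a::euclidean_space) manifold" and N :: "('n, 'b::euclidean_space) manifold"
    and \<phi> :: "'m \<Rightarrow> 'n" and U
  assumes M: "smooth_manifold M" and N: "smooth_manifold N" and \<phi>: "smooth_map M N \<phi>"
    and U: "openin (mtop M) U"
begin

lemma section_cong:
  assumes "section_along M N \<phi> U V" "\<And>p. p \<in> U \<Longrightarrow> V p = V' p"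
  shows "section_along M N \<phi> U V'"
proof (rule sectionI)
  fix W u assume W: "openin (mtop N) W" "smooth_fun N W u"
  show "smooth_fun M (U \<inter> \<phi> -` W) (\<lambda>p. V' p u)"
    by (rule smooth_fun_cong[OF M smooth_map_preimage[OF \<phi> U W(1)] _ section_smooth[OF assms(1) W]])
      (use assms(2) in auto)
qed (use assms in \<open>auto dest: section_tangent\<close>)

lemma section_add:
  assumes "section_along M N \<phi> U V" "section_along M N \<phi> U V'"
  shows "section_along M N \<phi> U (\<lambda>p. V p + V' p)"
proof (rule sectionI)
  fix p assume "p \<in> U"
  then show "V p + V' p \<in> tangent_space N (\<phi> p)"
    by (intro tangent_add[OF N] section_tangent[OF assms(1)] section_tangent[OF assms(2)])
next
  fix W w assume W: "openin (mtop N) W" "smooth_fun N W w"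
  show "smooth_fun M (U \<inter> \<phi> -` W) (\<lambda>p. (V p + V' p) w)"
    unfolding plus_fun_apply
    by (intro smooth_fun_add[OF M smooth_map_preimage[OF \<phi> U W(1)]]
        section_smooth[OF assms(1) W] section_smooth[OF assms(2) W])
qed

lemma section_scale:
  assumes "smooth_fun M U u" "section_along M N \<phi> U V"
  shows "section_along M N \<phi> U (\<lambda>p. u p \<cdot> V p)"
proof (rule sectionI)
  fix W w assume W: "openin (mtop N) W" "smooth_fun N W w"
  show "smooth_fun M (U \<inter> \<phi> -` W) (\<lambda>p. (u p \<cdot> V p) w)"
    unfolding tscale_def
    by (intro smooth_fun_mult[OF M smooth_map_preimage[OF \<phi> U W(1)]] section_smooth[OF assms(2) W]
        smooth_fun_subset[OF assms(1)]) auto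
qed (intro tangent_scale[OF N] section_tangent[OF assms(2)])

lemma section_zero: "section_along M N \<phi> U (\<lambda>p. 0)"
proof (rule sectionI)
  show "0 \<in> tangent_space N (\<phi> p)" if "p \<in> U" for p
    using that openin_subset[OF U] by (blast intro: tangent_zero[OF N] smooth_map_point[OF \<phi>])
qed (simp add: smooth_fun_const)

lemma section_sum:
  assumes "\<And>i. i \<in> I \<Longrightarrow> section_along M N \<phi> U (V i)"
  shows "section_along M N \<phi> U (\<lambda>p. \<Sum>i\<in>I. V i p)"
  using assms
  by (induction I rule: infinite_finite_induct) (auto intro: section_zero section_add)

lemma section_diff:
  assumes "section_along M N \<phi> U V" "section_along M N \<phi> U V'"
  shows "section_along M N \<phi> U (\<lambda>p. V p - V' p)"
  unfolding diff_eq_tscale by (intro section_add section_scale smooth_fun_const assms)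

text \<open>Where \<open>u\<close> is smooth, the section applied to \<open>u\<close> is
  \<open>X\<close> applied to the pulled-back function \<open>u \<circ> \<phi>\<close>, which is
  smooth because \<open>X\<close> is a vector field.\<close>

lemma section_differential:
  assumes X: "vector_field M U X"
  shows "section_along M N \<phi> U (\<lambda>p. differential N \<phi> p (X p))"
proof (rule sectionI)
  fix p assume "p \<in> U"
  then show "differential N \<phi> p (X p) \<in> tangent_space N (\<phi> p)"
    using differential_tangent[OF M N \<phi>] section_tangent[OF X] openin_subset[OF U] by auto
next
  fix W u assume W: "openin (mtop N) W" "smooth_fun N W u"
  have "smooth_fun M (U \<inter> id -` (points M \<inter> \<phi> -` W)) (\<lambda>p. X p (u \<circ> \<phi>))"
    by (rule section_smooth[OF X smooth_map_preimage[OF \<phi> openin_topspace W(1)]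
          smooth_fun_pullback[OF M N \<phi> W]])
  then have "smooth_fun M (U \<inter> \<phi> -` W) (\<lambda>p. X p (u \<circ> \<phi>))"
    by (rule smooth_fun_subset) (use openin_subset[OF U] in auto)
  then show "smooth_fun M (U \<inter> \<phi> -` W) (\<lambda>p. differential N \<phi> p (X p) u)"
    by (rule smooth_fun_cong[OF M smooth_map_preimage[OF \<phi> U W(1)], rotated])
      (use W in \<open>auto simp: differential_def smooth_near_def\<close>)
qed

end

section \<open>Local orthonormal frames\<close>

lemma coord_vec_sum:
  assumes "smooth_manifold M" "(U, \<psi>) \<in> charts M" "p \<in> U"
  shows "coord_vec M (U, \<psi>) p (\<Sum>i\<in>I. r i *\<^sub>R a i) = (\<Sum>i\<in>I. r i \<cdot> coord_vec M (U, \<psi>) p (a i))"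
proof -
  have "coord_vec M (U, \<psi>) p 0 = 0"
    using coord_vec_scale[OF assms, of 0 0] by (simp add: tscale_def fun_eq_iff)
  then show ?thesis
    by (induction I rule: infinite_finite_induct)
      (auto simp: coord_vec_add[OF assms] coord_vec_scale[OF assms])
qed

lemma coord_vec_diff:
  assumes "smooth_manifold M" "(U, \<psi>) \<in> charts M" "p \<in> U"
  shows "coord_vec M (U, \<psi>) p (a - b) = coord_vec M (U, \<psi>) p a - coord_vec M (U, \<psi>) p b"
  using coord_vec_add[OF assms, of "a - b" b] by simp

section \<open>Algebra of the metric and orthonormal frames\<close>

context
  fixes M :: "('m, 'a::euclidean_space) manifold" and g :: "'m \<Rightarrow> 'm tvec \<Rightarrow> 'm tvec \<Rightarrow> real"
  assumes Mg: "riemannian_manifold M g"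
begin

lemma riemannian_smooth: "smooth_manifold M"
  by (rule Mg[unfolded riemannian_manifold_def, THEN conjunct1])

lemma metric_smooth:
  "openin (mtop M) U \<Longrightarrow> vector_field M U X \<Longrightarrow> vector_field M U Y
    \<Longrightarrow> smooth_fun M U (\<lambda>p. g p (X p) (Y p))"
  using Mg[unfolded riemannian_manifold_def, THEN conjunct2, THEN conjunct2] by blast

lemma
  assumes v: "v \<in> tangent_space M p" and w: "w \<in> tangent_space M p"
  shows metric_sym: "g p v w = g p w v"
    and metric_add: "v' \<in> tangent_space M p \<Longrightarrow> g p (v + v') w = g p v w + g p v' w"
    and metric_scale: "g p (r \<cdot> v) w = r * g p v w"
    and metric_pos: "v \<noteq> 0 \<Longrightarrow> g p v v > 0"
proof -
  note bil = Mg[unfolded riemannian_manifold_def, THEN conjunct2, THEN conjunct1, THEN bspec,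
      OF tangent_space_points[OF riemannian_smooth v], THEN bspec, OF v, THEN bspec]
  show "g p v w = g p w v" "v' \<in> tangent_space M p \<Longrightarrow> g p (v + v') w = g p v w + g p v' w"
    "g p (r \<cdot> v) w = r * g p v w"
    using bil[OF w] by auto
  show "v \<noteq> 0 \<Longrightarrow> g p v v > 0"
    using bil[OF v] by auto
qed

lemma metric_zero:
  assumes "w \<in> tangent_space M p"
  shows "g p 0 w = 0"
proof -
  have "0 \<cdot> w = 0" by (simp add: tscale_def fun_eq_iff)
  then show ?thesis using metric_scale[OF assms assms, of 0] by simp
qed

lemma metric_sum:
  assumes "w \<in> tangent_space M p" "\<And>i. i \<in> I \<Longrightarrow> v i \<in> tangent_space M p"
  shows "g p (\<Sum>i\<in>I. r i \<cdot> v i) w = (\<Sum>i\<in>I. r i * g p (v i) w)"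
proof -
  note sm = riemannian_smooth
  have p: "p \<in> points M" by (rule tangent_space_points[OF sm assms(1)])
  show ?thesis
    using assms(2)
  proof (induction I rule: infinite_finite_induct)
    case (insert i I)
    have "g p (r i \<cdot> v i + (\<Sum>i\<in>I. r i \<cdot> v i)) w = g p (r i \<cdot> v i) w + g p (\<Sum>i\<in>I. r i \<cdot> v i) w"
      using insert assms(1) p by (intro metric_add) (auto intro!: tangent_sum tangent_scale sm)
    also have "\<dots> = (\<Sum>j\<in>insert i I. r j * g p (v j) w)"
      using insert assms(1) metric_scale by simp
    finally show ?case unfolding sum.insert[OF insert(1,2)] .
  qed (simp_all add: metric_zero[OF assms(1)])
qed

lemma metric_diff:
  assumes "v \<in> tangent_space M p" "v' \<in> tangent_space M p" "w \<in> tangent_space M p"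
  shows "g p (v - v') w = g p v w - g p v' w"
  unfolding diff_eq_tscale
  using assms by (simp add: metric_add metric_scale tangent_scale riemannian_smooth)

text \<open>The difference of the two sides is orthogonal to the whole frame. A dimension count
  shows that only the zero vector is.\<close>

lemma frame_expansion:
  assumes e: "\<And>i. i < DIM('a) \<Longrightarrow> e i \<in> tangent_space M p"
    and on: "\<And>i j. i < DIM('a) \<Longrightarrow> j < DIM('a) \<Longrightarrow> g p (e i) (e j) = (if i = j then 1 else 0)"
    and v: "v \<in> tangent_space M p"
  shows "v = (\<Sum>i<DIM('a). g p v (e i) \<cdot> e i)"
proof -
  note sm = riemannian_smooth
  have p: "p \<in> points M" by (rule tangent_space_points[OF sm v])
  obtain U \<psi> where c: "(U, \<psi>) \<in> charts M" "p \<in> U" using chart_exists[OF sm p] .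
  let ?c = "coord_vec M (U, \<psi>) p"
  note T = tangent_space_chart[OF sm c]
  have cT: "?c x \<in> tangent_space M p" for x unfolding T by simp
  obtain \<beta> where "bij_betw \<beta> {0..<DIM('a)} (Basis :: 'a set)"
    using ex_bij_betw_nat_finite[OF finite_Basis] by blast
  then have \<beta>: "bij_betw \<beta> {..<DIM('a)} (Basis :: 'a set)" by (simp add: atLeast0LessThan)
  \<comment> \<open>\<open>L\<close> stores the frame coefficients of a coordinate vector as an
    element of the model space, with \<beta> numbering its basis. As a linear endomorphism it is
    injective once it is surjective, and surjectivity is visible because the frame vectors are sent
    to the basis.\<close>
  define L where "L x = (\<Sum>i<DIM('a). g p (?c x) (e i) *\<^sub>R \<beta> i)" for x
  have "linear L"
  proof (rule linearI)
    show "L (x + y) = L x + L y" for x y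
      by (simp add: L_def coord_vec_add[OF sm c] metric_add cT e scaleR_add_left sum.distrib)
    show "L (r *\<^sub>R x) = r *\<^sub>R L x" for r x
      by (simp add: L_def coord_vec_scale[OF sm c] metric_scale cT e scaleR_sum_right)
  qed
  obtain a where a: "\<And>i. i < DIM('a) \<Longrightarrow> e i = ?c (a i)"
    using e unfolding T image_iff by metis
  have La: "L (a j) = \<beta> j" if "j < DIM('a)" for j
    unfolding L_def using that by (simp add: a[symmetric] on if_distrib[of "\<lambda>r. r *\<^sub>R _"] cong: if_cong)
  have "surj L"
  proof (rule surjI)
    fix y
    have "L (\<Sum>i<DIM('a). (y \<bullet> \<beta> i) *\<^sub>R a i) = (\<Sum>i<DIM('a). (y \<bullet> \<beta> i) *\<^sub>R \<beta> i)"
      by (simp add: linear_sum[OF \<open>linear L\<close>] linear_scale[OF \<open>linear L\<close>] La)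
    also have "\<dots> = (\<Sum>b\<in>Basis. (y \<bullet> b) *\<^sub>R b)"
      by (rule sum.reindex_bij_betw[OF \<beta>])
    finally show "L (\<Sum>i<DIM('a). (y \<bullet> \<beta> i) *\<^sub>R a i) = y" by (simp add: euclidean_representation)
  qed
  then have "inj L" using linear_surj_imp_inj[OF \<open>linear L\<close>] by blast
  define w where "w = v - (\<Sum>i<DIM('a). g p v (e i) \<cdot> e i)"
  have sT: "(\<Sum>i<DIM('a). g p v (e i) \<cdot> e i) \<in> tangent_space M p"
    using e by (intro tangent_sum tangent_scale sm p) auto
  have "w \<in> tangent_space M p" unfolding w_def by (intro tangent_diff sm v sT)
  then obtain x where x: "w = ?c x" unfolding T by auto
  have "g p w (e j) = 0" if "j < DIM('a)" for j
  proof -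
    have "g p (\<Sum>i<DIM('a). g p v (e i) \<cdot> e i) (e j) = (\<Sum>i<DIM('a). g p v (e i) * g p (e i) (e j))"
      using e that by (intro metric_sum) auto
    also have "\<dots> = g p v (e j)"
      using that by (simp add: on if_distrib[of "\<lambda>r. _ * r"] cong: if_cong)
    finally show ?thesis
      unfolding w_def using metric_diff[OF v sT e[OF that]] by simp
  qed
  then have "L x = 0" unfolding L_def x[symmetric] by simp
  then have "x = 0"
    using \<open>inj L\<close> linear_0[OF \<open>linear L\<close>] by (metis injD)
  \<comment> \<open>The empty sum gives that the coordinate vector of direction 0 vanishes.\<close>
  then have "w = 0" unfolding x using coord_vec_sum[OF sm c, of _ _ "{}"] by simp
  then show ?thesis unfolding w_def by simp
qed

text \<open>Gram--Schmidt, applied to the coordinate vector fields of a chart.\<close>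

lemma local_onf_exists:
  assumes "p \<in> points M"
  shows "\<exists>e U. openin (mtop M) U \<and> p \<in> U \<and> local_onf M g U e"
proof -
  note sm = riemannian_smooth
  obtain U \<psi> where c: "(U, \<psi>) \<in> charts M" "p \<in> U" using chart_exists[OF sm assms] .
  let ?c = "coord_vec M (U, \<psi>)"
  have U: "openin (mtop M) U" by (rule chartD(1)[OF sm c(1)])
  note sid = smooth_map_id[OF sm]
  have cT: "?c q x \<in> tangent_space M q" if "q \<in> U" for q x
    using tangent_space_chart[OF sm c(1) that] by simp
  obtain \<beta> where "bij_betw \<beta> {0..<DIM('a)} (Basis :: 'a set)"
    using ex_bij_betw_nat_finite[OF finite_Basis] by blast
  then have \<beta>: "bij_betw \<beta> {..<DIM('a)} (Basis :: 'a set)" by (simp add: atLeast0LessThan)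
  \<comment> \<open>The middle clause confines the first \<open>k\<close> fields to the span of the
    first \<open>k\<close> coordinate directions. It ensures that the next coordinate vector does
    not lie in their span, so that a nonzero remainder is left to normalise at every point of
    \<open>U\<close>.\<close>
  have "\<exists>e. (\<forall>i<k. vector_field M U (e i)) \<and>
      (\<forall>q\<in>U. \<forall>i<k. e i q \<in> ?c q ` span (\<beta> ` {..<k})) \<and>
      (\<forall>q\<in>U. \<forall>i<k. \<forall>j<k. g q (e i q) (e j q) = (if i = j then 1 else 0))"
    if "k \<le> DIM('a)" for k
    using that
  proof (induction k)
    case (Suc k)
    then obtain e where e: "\<And>i. i < k \<Longrightarrow> vector_field M U (e i)"
      and sp: "\<And>q i. q \<in> U \<Longrightarrow> i < k \<Longrightarrow> e i q \<in> ?c q ` span (\<beta> ` {..<k})"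
      and on: "\<And>q i j. q \<in> U \<Longrightarrow> i < k \<Longrightarrow> j < k \<Longrightarrow> g q (e i q) (e j q) = (if i = j then 1 else 0)"
      by (metis Suc_leD)
    have eT: "e i q \<in> tangent_space M q" if "i < k" "q \<in> U" for i q
      using section_tangent[OF e] that by simp
    \<comment> \<open>The next coordinate field minus its orthogonal projection onto the fields
      found so far.\<close>
    define w where "w q = ?c q (\<beta> k) - (\<Sum>i<k. g q (?c q (\<beta> k)) (e i q) \<cdot> e i q)" for q
    have w: "vector_field M U w"
      unfolding w_def
      by (intro section_diff[OF sm sm sid U] section_sum[OF sm sm sid U] section_scale[OF sm sm sid U]
          vector_field_coord[OF sm c(1)] metric_smooth[OF U] e) auto
    have wT: "w q \<in> tangent_space M q" if "q \<in> U" for q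
      using section_tangent[OF w] that by simp
    have wc: "\<exists>s\<in>span (\<beta> ` {..<k}). w q = ?c q (\<beta> k - s)" if q: "q \<in> U" for q
    proof -
      obtain a where a: "\<And>i. i < k \<Longrightarrow> a i \<in> span (\<beta> ` {..<k})" "\<And>i. i < k \<Longrightarrow> e i q = ?c q (a i)"
        using sp[OF q] unfolding image_iff by metis
      have "w q = ?c q (\<beta> k - (\<Sum>i<k. g q (?c q (\<beta> k)) (e i q) *\<^sub>R a i))"
        unfolding coord_vec_diff[OF sm c(1) q] coord_vec_sum[OF sm c(1) q] w_def using a(2) by simp
      then show ?thesis using a(1) by (auto intro!: span_sum span_scale)
    qed
    have notin: "\<beta> k \<notin> span (\<beta> ` {..<k})"
    proof -
      have "\<beta> ` {..<k} \<subseteq> Basis - {\<beta> k}" "\<beta> k \<in> Basis"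
        using bij_betw_apply[OF \<beta>] inj_onD[OF bij_betw_imp_inj_on[OF \<beta>]] Suc.prems
        by (force simp: Suc_le_eq)+
      then show ?thesis
        using independent_Basis span_mono unfolding dependent_def by blast
    qed
    have wne: "w q \<noteq> 0" if q: "q \<in> U" for q
    proof
      assume "w q = 0"
      obtain s where "s \<in> span (\<beta> ` {..<k})" "w q = ?c q (\<beta> k - s)" using wc[OF q] by blast
      then show False using coord_vec_eq_0[OF sm c(1) q] \<open>w q = 0\<close> notin by force
    qed
    have pos: "g q (w q) (w q) > 0" if "q \<in> U" for q
      using metric_pos[OF wT wT wne] that by blast
    have worth: "g q (w q) (e j q) = 0" if q: "q \<in> U" and "j < k" for q j
    proof -
      have sT: "(\<Sum>i<k. g q (?c q (\<beta> k)) (e i q) \<cdot> e i q) \<in> tangent_space M q"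
        using q eT openin_subset[OF U] by (intro tangent_sum tangent_scale sm) auto
      have "g q (\<Sum>i<k. g q (?c q (\<beta> k)) (e i q) \<cdot> e i q) (e j q) =
          (\<Sum>i<k. g q (?c q (\<beta> k)) (e i q) * g q (e i q) (e j q))"
        using eT that by (intro metric_sum) auto
      also have "\<dots> = g q (?c q (\<beta> k)) (e j q)"
        using that by (simp add: on if_distrib[of "\<lambda>r. _ * r"] cong: if_cong)
      finally show ?thesis
        unfolding w_def using metric_diff[OF cT[OF q] sT eT[OF that(2) q]] by simp
    qed
    \<comment> \<open>The reciprocal of the norm of \<open>w\<close>, smooth since the squared norm
      is smooth and positive.\<close>
    define r where "r q = g q (w q) (w q) powr (- 1 / 2)" for q
    have r: "smooth_fun M U r"
      unfolding r_def by (rule smooth_fun_powr[OF sm U metric_smooth[OF U w w] pos])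
    define e' where "e' = e(k := \<lambda>q. r q \<cdot> w q)"
    have e'k: "e' k = (\<lambda>q. r q \<cdot> w q)" and e'i: "\<And>i. i < k \<Longrightarrow> e' i = e i"
      by (auto simp: e'_def)
    show ?case
    proof (intro exI[of _ e'] conjI ballI allI impI)
      fix i assume "i < Suc k"
      then show "vector_field M U (e' i)"
        using section_scale[OF sm sm sid U r w] e by (cases "i = k") (auto simp: e'k e'i)
    next
      fix q i assume q: "q \<in> U" and i: "i < Suc k"
      have mono: "span (\<beta> ` {..<k}) \<subseteq> span (\<beta> ` {..<Suc k})" by (intro span_mono) auto
      show "e' i q \<in> ?c q ` span (\<beta> ` {..<Suc k})"
      proof (cases "i = k")
        case True
        obtain s where s: "s \<in> span (\<beta> ` {..<k})" "w q = ?c q (\<beta> k - s)" using wc[OF q] by blast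
        have "r q *\<^sub>R (\<beta> k - s) \<in> span (\<beta> ` {..<Suc k})"
          using s(1) mono by (intro span_scale span_diff) (auto intro: span_base)
        then show ?thesis
          using True s(2) coord_vec_scale[OF sm c(1) q] by (auto simp: e'k intro!: image_eqI)
      next
        case False
        then show ?thesis using sp[OF q, of i] mono i by (auto simp: e'i)
      qed
    next
      fix q i j assume q: "q \<in> U" and ij: "i < Suc k" "j < Suc k"
      \<comment> \<open>Bracketed as it arises when \<open>metric_scale\<close>, which acts on the
        first slot, is used once directly and once after \<open>metric_sym\<close>.\<close>
      have rr: "r q * (r q * g q (w q) (w q)) = 1"
      proof -
        have "r q * r q = inverse (g q (w q) (w q))"
          using pos[OF q] unfolding r_def powr_add[symmetric] by (simp add: powr_minus)
        then show ?thesis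
          using pos[OF q] by (simp add: mult.assoc[symmetric])
      qed
      note rT = tangent_scale[OF sm wT[OF q]]
      have 1: "g q (r q \<cdot> w q) (r q \<cdot> w q) = 1"
        using rr metric_sym[OF wT[OF q] rT] by (simp add: metric_scale wT q rT)
      have 2: "g q (r q \<cdot> w q) (e m q) = 0" if "m < k" for m
        using that q by (simp add: metric_scale wT eT worth)
      have 3: "g q (e m q) (r q \<cdot> w q) = 0" if "m < k" for m
        using 2[OF that] metric_sym[OF rT eT[OF that q]] by simp
      show "g q (e' i q) (e' j q) = (if i = j then 1 else 0)"
        using ij 1 2 3 on[OF q] by (auto simp: less_Suc_eq e'k e'i)
    qed
  qed auto
  then obtain e where "\<forall>i<DIM('a). vector_field M U (e i)"
    "\<forall>q\<in>U. \<forall>i<DIM('a). \<forall>j<DIM('a). g q (e i q) (e j q) = (if i = j then 1 else 0)"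
    by (metis order_refl)
  then show ?thesis using U c(2) unfolding local_onf_def by blast
qed

end

section \<open>Connections, traces and gradients\<close>

lemma sum_fun_apply: "(\<Sum>i\<in>I. F i) u = (\<Sum>i\<in>I. F i u)"
  by (induction I rule: infinite_finite_induct) auto

text \<open>The differential is precomposition with \<phi> followed by a cutoff that does not depend
  on the vector, so it is additive on arbitrary functionals.\<close>

lemma differential_sum:
  "differential N \<phi> p (\<Sum>i\<in>I. v i) = (\<Sum>i\<in>I. differential N \<phi> p (v i))"
  by (auto simp: fun_eq_iff differential_def sum_fun_apply)

lemma differential_add: "differential N \<phi> p (v + w) = differential N \<phi> p v + differential N \<phi> p w"
  by (auto simp: fun_eq_iff differential_def)

lemma differential_scale: "differential N \<phi> p (r \<cdot> v) = r \<cdot> differential N \<phi> p v"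
  by (auto simp: fun_eq_iff differential_def tscale_def)

section \<open>Linearity and Leibniz rules of a connection over a fixed open set\<close>

context
  fixes M :: "('m, 'a::euclidean_space) manifold" and N :: "('n, 'b::euclidean_space) manifold"
    and \<phi> :: "'m \<Rightarrow> 'n" and D :: "('m, 'n) cov" and U
  assumes D: "connection_along M N \<phi> D" and U: "openin (mtop M) U"
begin

lemma connection_section:
  "section_along M N \<phi> U V \<Longrightarrow> vector_field M U X \<Longrightarrow> section_along M N \<phi> U (\<lambda>p. D p (X p) V)"
  using D[unfolded connection_along_def, THEN spec, THEN spec, THEN mp, OF conjI, OF U,
      THEN conjunct2] by blast

lemma
  assumes V: "section_along M N \<phi> U V" and p: "p \<in> U" and v: "v \<in> tangent_space M p"
  shows connection_tangent: "D p v V \<in> tangent_space N (\<phi> p)"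
    and connection_add_dir: "w \<in> tangent_space M p \<Longrightarrow> D p (v + w) V = D p v V + D p w V"
    and connection_scale_dir: "D p (r \<cdot> v) V = r \<cdot> D p v V"
    and connection_add: "section_along M N \<phi> U W \<Longrightarrow> D p v (\<lambda>q. V q + W q) = D p v V + D p v W"
    and connection_leibniz:
      "smooth_fun M U u \<Longrightarrow> D p v (\<lambda>q. u q \<cdot> V q) = v u \<cdot> V p + u p \<cdot> D p v V"
    and connection_local: "(\<And>q. q \<in> U \<Longrightarrow> W q = V q) \<Longrightarrow> D p v W = D p v V"
proof -
  note conn = D[unfolded connection_along_def, THEN spec, THEN spec, THEN mp, OF conjI, OF U V,
      THEN conjunct1, THEN bspec, OF p, THEN bspec, OF v]
  show "D p v V \<in> tangent_space N (\<phi> p)"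
    "w \<in> tangent_space M p \<Longrightarrow> D p (v + w) V = D p v V + D p w V"
    "D p (r \<cdot> v) V = r \<cdot> D p v V"
    "section_along M N \<phi> U W \<Longrightarrow> D p v (\<lambda>q. V q + W q) = D p v V + D p v W"
    "smooth_fun M U u \<Longrightarrow> D p v (\<lambda>q. u q \<cdot> V q) = v u \<cdot> V p + u p \<cdot> D p v V"
    "(\<And>q. q \<in> U \<Longrightarrow> W q = V q) \<Longrightarrow> D p v W = D p v V"
    using conn by blast+
qed

context
  assumes M: "smooth_manifold M" and N: "smooth_manifold N" and \<phi>: "smooth_map M N \<phi>"
begin

lemma connection_sum_dir:
  assumes V: "section_along M N \<phi> U V" and p: "p \<in> U"
    and v: "\<And>i. i \<in> I \<Longrightarrow> v i \<in> tangent_space M p"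
  shows "D p (\<Sum>i\<in>I. r i \<cdot> v i) V = (\<Sum>i\<in>I. r i \<cdot> D p (v i) V)"
proof -
  have pM: "p \<in> points M" using p openin_subset[OF U] by auto
  have 0: "D p 0 V = 0"
    using connection_add_dir[OF V p tangent_zero[OF M pM] tangent_zero[OF M pM]] by simp
  show ?thesis
    using v
  proof (induction I rule: infinite_finite_induct)
    case (insert i I)
    have "D p (r i \<cdot> v i + (\<Sum>i\<in>I. r i \<cdot> v i)) V = D p (r i \<cdot> v i) V + D p (\<Sum>i\<in>I. r i \<cdot> v i) V"
      using insert.prems pM
      by (intro connection_add_dir[OF V p] tangent_sum[OF M] tangent_scale[OF M]) auto
    also have "\<dots> = (\<Sum>j\<in>insert i I. r j \<cdot> D p (v j) V)"
      using insert connection_scale_dir[OF V p] by simp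
    finally show ?case unfolding sum.insert[OF insert(1,2)] .
  qed (simp_all add: 0)
qed

lemma connection_sum:
  assumes p: "p \<in> U" and v: "v \<in> tangent_space M p"
    and V: "\<And>i. i \<in> I \<Longrightarrow> section_along M N \<phi> U (V i)"
  shows "D p v (\<lambda>q. \<Sum>i\<in>I. V i q) = (\<Sum>i\<in>I. D p v (V i))"
proof -
  note zero = section_zero[OF M N \<phi> U]
  have 0: "D p v (\<lambda>q. 0) = 0" using connection_add[OF zero p v zero] by simp
  show ?thesis
    using V
  proof (induction I rule: infinite_finite_induct)
    case (insert i I)
    have "D p v (\<lambda>q. V i q + (\<Sum>i\<in>I. V i q)) = D p v (V i) + D p v (\<lambda>q. \<Sum>i\<in>I. V i q)"
      using insert.prems by (intro connection_add[OF _ p v] section_sum[OF M N \<phi> U]) auto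
    also have "\<dots> = (\<Sum>j\<in>insert i I. D p v (V j))"
      using insert by simp
    finally show ?case unfolding sum.insert[OF insert(1,2)] .
  qed (simp_all add: 0)
qed

text \<open>The Leibniz rule for a section expanded in a frame. The expansion holds on
  \<open>U\<close> only, so locality first replaces \<open>W\<close> by the sum.\<close>

lemma connection_combination:
  assumes p: "p \<in> U" and v: "v \<in> tangent_space M p"
    and V: "\<And>i. i \<in> I \<Longrightarrow> section_along M N \<phi> U (V i)" and u: "\<And>i. i \<in> I \<Longrightarrow> smooth_fun M U (u i)"
    and W: "\<And>q. q \<in> U \<Longrightarrow> W q = (\<Sum>i\<in>I. u i q \<cdot> V i q)"
  shows "D p v W = (\<Sum>i\<in>I. v (u i) \<cdot> V i p + u i p \<cdot> D p v (V i))"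
proof -
  have s: "section_along M N \<phi> U (\<lambda>q. u i q \<cdot> V i q)" if "i \<in> I" for i
    by (rule section_scale[OF M N \<phi> U u[OF that] V[OF that]])
  have "D p v W = D p v (\<lambda>q. \<Sum>i\<in>I. u i q \<cdot> V i q)"
    by (rule connection_local[OF section_sum[OF M N \<phi> U s] p v W])
  also have "\<dots> = (\<Sum>i\<in>I. D p v (\<lambda>q. u i q \<cdot> V i q))"
    by (rule connection_sum[OF p v s])
  also have "\<dots> = (\<Sum>i\<in>I. v (u i) \<cdot> V i p + u i p \<cdot> D p v (V i))"
    by (rule sum.cong[OF refl]) (rule connection_leibniz[OF V p v u])
  finally show ?thesis .
qed

end

end

text \<open>The second fundamental form of \<phi>, the covariant derivative of its differential; its
  trace is the tension field. The second argument is a field because it gets differentiated,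
  although the value depends only on the field at \<open>p\<close>.\<close>

definition second_form ::
    "('m, 'm) cov \<Rightarrow> ('n, 'b::euclidean_space) manifold \<Rightarrow> ('m \<Rightarrow> 'n) \<Rightarrow> ('m, 'n) cov \<Rightarrow>
     'm \<Rightarrow> 'm tvec \<Rightarrow> ('m \<Rightarrow> 'm tvec) \<Rightarrow> 'n tvec" where
  "second_form DM N \<phi> D p v Y =
     D p v (\<lambda>q. differential N \<phi> q (Y q)) - differential N \<phi> p (DM p v Y)"

context
  fixes M :: "('m, 'a::euclidean_space) manifold" and N :: "('n, 'b::euclidean_space) manifold"
    and \<phi> :: "'m \<Rightarrow> 'n" and DM :: "('m, 'm) cov" and D :: "('m, 'n) cov" and U
  assumes M: "smooth_manifold M" and N: "smooth_manifold N" and \<phi>: "smooth_map M N \<phi>"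
    and DM: "connection_along M M id DM" and D: "connection_along M N \<phi> D"
    and U: "openin (mtop M) U"
begin

lemma second_form_sum_dir:
  assumes Y: "vector_field M U Y" and p: "p \<in> U"
    and v: "\<And>i. i \<in> I \<Longrightarrow> v i \<in> tangent_space M p"
  shows "second_form DM N \<phi> D p (\<Sum>i\<in>I. r i \<cdot> v i) Y = (\<Sum>i\<in>I. r i \<cdot> second_form DM N \<phi> D p (v i) Y)"
proof -
  have "DM p (\<Sum>i\<in>I. r i \<cdot> v i) Y = (\<Sum>i\<in>I. r i \<cdot> DM p (v i) Y)"
    by (rule connection_sum_dir[OF DM U M M smooth_map_id[OF M] Y p v])
  moreover have "D p (\<Sum>i\<in>I. r i \<cdot> v i) (\<lambda>q. differential N \<phi> q (Y q)) =
      (\<Sum>i\<in>I. r i \<cdot> D p (v i) (\<lambda>q. differential N \<phi> q (Y q)))"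
    by (rule connection_sum_dir[OF D U M N \<phi> section_differential[OF M N \<phi> U Y] p v])
  ultimately have "second_form DM N \<phi> D p (\<Sum>i\<in>I. r i \<cdot> v i) Y =
      (\<Sum>i\<in>I. r i \<cdot> D p (v i) (\<lambda>q. differential N \<phi> q (Y q)))
      - (\<Sum>i\<in>I. r i \<cdot> differential N \<phi> p (DM p (v i) Y))"
    by (simp only: second_form_def differential_sum differential_scale)
  then show ?thesis
    by (simp add: second_form_def fun_eq_iff sum_fun_apply tscale_def right_diff_distrib sum_subtractf)
qed

text \<open>The derivatives of the coefficients cancel, since they occur in both terms of
  \<open>second_form\<close>.\<close>

lemma second_form_combination:
  assumes Y: "\<And>i. i \<in> I \<Longrightarrow> vector_field M U (Y i)" and p: "p \<in> U" and v: "v \<in> tangent_space M p"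
    and u: "\<And>i. i \<in> I \<Longrightarrow> smooth_fun M U (u i)"
    and Z: "\<And>q. q \<in> U \<Longrightarrow> Z q = (\<Sum>i\<in>I. u i q \<cdot> Y i q)"
  shows "second_form DM N \<phi> D p v Z = (\<Sum>i\<in>I. u i p \<cdot> second_form DM N \<phi> D p v (Y i))"
proof -
  have "DM p v Z = (\<Sum>i\<in>I. v (u i) \<cdot> Y i p + u i p \<cdot> DM p v (Y i))"
    by (rule connection_combination[OF DM U M M smooth_map_id[OF M] p v Y u Z])
  moreover have "D p v (\<lambda>q. differential N \<phi> q (Z q)) =
      (\<Sum>i\<in>I. v (u i) \<cdot> differential N \<phi> p (Y i p)
        + u i p \<cdot> D p v (\<lambda>q. differential N \<phi> q (Y i q)))"
    by (rule connection_combination[OF D U M N \<phi> p v section_differential[OF M N \<phi> U Y] u])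
      (simp_all only: Z differential_sum differential_scale)
  moreover have "differential N \<phi> p (\<Sum>i\<in>I. v (u i) \<cdot> Y i p + u i p \<cdot> DM p v (Y i)) =
      (\<Sum>i\<in>I. v (u i) \<cdot> differential N \<phi> p (Y i p) + u i p \<cdot> differential N \<phi> p (DM p v (Y i)))"
    by (simp only: differential_sum differential_add differential_scale)
  ultimately have "second_form DM N \<phi> D p v Z =
      (\<Sum>i\<in>I. v (u i) \<cdot> differential N \<phi> p (Y i p)
        + u i p \<cdot> D p v (\<lambda>q. differential N \<phi> q (Y i q)))
      - (\<Sum>i\<in>I. v (u i) \<cdot> differential N \<phi> p (Y i p) + u i p \<cdot> differential N \<phi> p (DM p v (Y i)))"
    by (simp only: second_form_def)
  then show ?thesis
    by (simp add: second_form_def fun_eq_iff sum_fun_apply tscale_def right_diff_distrib sum.distrib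
        sum_subtractf)
qed

end

section \<open>Traces and gradients in an orthonormal frame\<close>

context
  fixes M :: "('m, 'a::euclidean_space) manifold" and g :: "'m \<Rightarrow> 'm tvec \<Rightarrow> 'm tvec \<Rightarrow> real"
  assumes Mg: "riemannian_manifold M g"
begin

lemma local_onfD:
  assumes "local_onf M g U e" "i < DIM('a)"
  shows "vector_field M U (e i)" "q \<in> U \<Longrightarrow> e i q \<in> tangent_space M q"
    "q \<in> U \<Longrightarrow> j < DIM('a) \<Longrightarrow> g q (e i q) (e j q) = (if i = j then 1 else 0)"
proof -
  show X: "vector_field M U (e i)" using assms unfolding local_onf_def by blast
  show "q \<in> U \<Longrightarrow> e i q \<in> tangent_space M q" using section_tangent[OF X] by simp
  show "q \<in> U \<Longrightarrow> j < DIM('a) \<Longrightarrow> g q (e i q) (e j q) = (if i = j then 1 else 0)"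
    using assms unfolding local_onf_def by blast
qed

lemma local_onf_expansion:
  assumes "local_onf M g U e" "q \<in> U" "v \<in> tangent_space M q"
  shows "v = (\<Sum>i<DIM('a). g q v (e i q) \<cdot> e i q)"
  using assms(2,3) by (intro frame_expansion[OF Mg] local_onfD[OF assms(1)])

text \<open>One chosen frame serves every \<open>B\<close>. The trace is stated twice because
  \<open>B\<close> has a fixed type inside the rule: real values for the divergence, tangent vectors
  for the Hessian and the tension.\<close>

lemma trace_at_frame:
  assumes "p \<in> points M"
  obtains e U where "openin (mtop M) U" "p \<in> U" "local_onf M g U e"
    "\<And>B. trace_at M g p B = (\<Sum>i<DIM('a). B (e i) :: real)"
    "\<And>B. trace_at M g p B = (\<Sum>i<DIM('a). B (e i) :: 'n tvec)"
proof -
  define e where "e = (SOME e. \<exists>U. openin (mtop M) U \<and> p \<in> U \<and> local_onf M g U e)"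
  have "\<exists>U. openin (mtop M) U \<and> p \<in> U \<and> local_onf M g U e"
    using someI_ex[OF local_onf_exists[OF Mg assms]] unfolding e_def .
  then show ?thesis using that unfolding trace_at_def Let_def e_def[symmetric] by blast
qed

text \<open>The coefficients of the gradient in an orthonormal frame must be its products with the
  frame vectors, that is, the derivatives of \<open>f\<close> along them. The resulting sum
  represents \<open>w f\<close> for every \<open>w\<close>, and positive definiteness makes the
  representing vector unique.\<close>

lemma
  assumes "p \<in> points M"
  shows grad_tangent: "grad M g f p \<in> tangent_space M p"
    and metric_grad: "w \<in> tangent_space M p \<Longrightarrow> g p (grad M g f p) w = w f"
    and grad_frame: "local_onf M g U e \<Longrightarrow> p \<in> U \<Longrightarrow> grad M g f p = (\<Sum>i<DIM('a). e i p f \<cdot> e i p)"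
proof -
  note sm = riemannian_smooth[OF Mg]
  have *: "(\<Sum>i<DIM('a). e i p f \<cdot> e i p) \<in> tangent_space M p \<and>
      (\<forall>w\<in>tangent_space M p. g p (\<Sum>i<DIM('a). e i p f \<cdot> e i p) w = w f)"
    if e: "local_onf M g U e" and p: "p \<in> U" for e U
  proof (intro conjI ballI)
    show "(\<Sum>i<DIM('a). e i p f \<cdot> e i p) \<in> tangent_space M p"
      using p by (intro tangent_sum[OF sm assms] tangent_scale[OF sm] local_onfD[OF e]) auto
    fix w assume w: "w \<in> tangent_space M p"
    have "g p (\<Sum>i<DIM('a). e i p f \<cdot> e i p) w = (\<Sum>i<DIM('a). e i p f * g p (e i p) w)"
      using p by (intro metric_sum[OF Mg w] local_onfD[OF e]) auto
    also have "\<dots> = (\<Sum>i<DIM('a). g p w (e i p) * e i p f)"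
      using metric_sym[OF Mg w local_onfD(2)[OF e _ p]] by (intro sum.cong) auto
    \<comment> \<open>Vectors are functionals, so the frame expansion of \<open>w\<close> can be
      evaluated at \<open>f\<close>.\<close>
    also have "\<dots> = (\<Sum>i<DIM('a). g p w (e i p) \<cdot> e i p) f"
      by (simp add: sum_fun_apply tscale_def)
    also have "\<dots> = w f" using local_onf_expansion[OF e p w] by simp
    finally show "g p (\<Sum>i<DIM('a). e i p f \<cdot> e i p) w = w f" .
  qed
  have uniq: "v = v'"
    if "v \<in> tangent_space M p \<and> (\<forall>w\<in>tangent_space M p. g p v w = w f)"
      "v' \<in> tangent_space M p \<and> (\<forall>w\<in>tangent_space M p. g p v' w = w f)" for v v'
  proof (rule ccontr)
    assume ne: "v \<noteq> v'"
    have T: "v - v' \<in> tangent_space M p" using that tangent_diff[OF sm] by blast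
    then have "g p (v - v') (v - v') = 0" using that metric_diff[OF Mg] by auto
    moreover have "g p (v - v') (v - v') > 0" using metric_pos[OF Mg T T] ne by simp
    ultimately show False by simp
  qed
  have eq: "grad M g f p = (\<Sum>i<DIM('a). e i p f \<cdot> e i p)"
    if "local_onf M g U e" "p \<in> U" for e U
    unfolding grad_def using *[OF that] uniq by (intro the_equality)
  then show "local_onf M g U e \<Longrightarrow> p \<in> U \<Longrightarrow> grad M g f p = (\<Sum>i<DIM('a). e i p f \<cdot> e i p)" .
  obtain e' U' where e': "p \<in> U'" "local_onf M g U' e'"
    using local_onf_exists[OF Mg assms] by blast
  show "grad M g f p \<in> tangent_space M p"
    "w \<in> tangent_space M p \<Longrightarrow> g p (grad M g f p) w = w f"
    using *[OF e'(2,1)] eq[OF e'(2,1)] by auto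
qed

lemma grad_vector_field:
  assumes U: "openin (mtop M) U" and e: "local_onf M g U e" and f: "smooth_fun M U f"
  shows "vector_field M U (grad M g f)"
proof -
  note sm = riemannian_smooth[OF Mg]
  note sid = smooth_map_id[OF sm]
  have "vector_field M U (\<lambda>p. \<Sum>i<DIM('a). e i p f \<cdot> e i p)"
    by (intro section_sum[OF sm sm sid U] section_scale[OF sm sm sid U]
        vector_field_apply[OF _ U f] local_onfD(1)[OF e]) auto
  then show ?thesis
    by (rule section_cong[OF sm sm sid U])
      (use grad_frame e openin_subset[OF U] in \<open>auto simp: subset_iff\<close>)
qed

end

text \<open>Frame independence: \<open>tension\<close> picks a frame at each point separately, so that its smoothness
  is only visible after the frames have been exchanged for one frame on an open set.\<close>

lemma tension_frame:
  fixes M :: "('m, 'a::euclidean_space) manifold" and N :: "('n, 'b::euclidean_space) manifold"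
  assumes Mg: "riemannian_manifold M g" and N: "smooth_manifold N" and \<phi>: "smooth_map M N \<phi>"
    and DM: "connection_along M M id DM" and D: "connection_along M N \<phi> D"
    and U: "openin (mtop M) U" and E: "local_onf M g U E" and p: "p \<in> U"
  shows "tension M g DM N \<phi> D p = (\<Sum>j<DIM('a). second_form DM N \<phi> D p (E j p) (E j))"
proof -
  note sm = riemannian_smooth[OF Mg]
  have "p \<in> points M" using p openin_subset[OF U] by auto
  then obtain e U' where U': "openin (mtop M) U'" "p \<in> U'" and e: "local_onf M g U' e"
    and tr: "\<And>B. trace_at M g p B = (\<Sum>i<DIM('a). B (e i) :: 'n tvec)"
    using trace_at_frame[OF Mg] by metis
  \<comment> \<open>Both frames live on \<open>W\<close>, so the coefficients between them are
    smooth there, as the second slot of \<open>second_form\<close> requires.\<close>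
  define W where "W = U \<inter> U'"
  have W: "openin (mtop M) W" "p \<in> W" using U U' p by (auto simp: W_def)
  have sub: "vector_field M W (E i)" "vector_field M W (e i)" if "i < DIM('a)" for i
    using local_onfD(1)[OF Mg E that] local_onfD(1)[OF Mg e that]
    by (auto intro: section_subset simp: W_def)
  define x where "x i j q = g q (e i q) (E j q)" for i j q
  have x: "smooth_fun M W (x i j)" if "i < DIM('a)" "j < DIM('a)" for i j
    unfolding x_def using that by (intro metric_smooth[OF Mg W(1)] sub)
  have "second_form DM N \<phi> D p (e i p) (e i) =
      (\<Sum>j<DIM('a). x i j p \<cdot> second_form DM N \<phi> D p (e i p) (E j))" if i: "i < DIM('a)" for i
  proof (rule second_form_combination[OF sm N \<phi> DM D W(1) _ W(2)])
    show "e i p \<in> tangent_space M p" by (rule local_onfD(2)[OF Mg e i U'(2)])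
    show "e i q = (\<Sum>j<DIM('a). x i j q \<cdot> E j q)" if "q \<in> W" for q
      unfolding x_def using that W_def
      by (intro local_onf_expansion[OF Mg E] local_onfD(2)[OF Mg e i]) auto
  qed (use i x sub in auto)
  then have "tension M g DM N \<phi> D p =
      (\<Sum>i<DIM('a). \<Sum>j<DIM('a). x i j p \<cdot> second_form DM N \<phi> D p (e i p) (E j))"
    unfolding tension_def tr second_form_def[symmetric] by simp
  \<comment> \<open>Only the second slot has been expanded, \<open>e i\<close> in terms of
    \<open>E\<close>. After the swap the same coefficients, by symmetry of \<open>g\<close>, are
    those of \<open>E j\<close> in terms of \<open>e\<close>, and the inner sum reassembles the
    first slot into \<open>E j p\<close>.\<close>
  also have "\<dots> = (\<Sum>j<DIM('a). \<Sum>i<DIM('a). x i j p \<cdot> second_form DM N \<phi> D p (e i p) (E j))"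
    by (rule sum.swap)
  also have "\<dots> = (\<Sum>j<DIM('a). second_form DM N \<phi> D p (E j p) (E j))"
  proof (rule sum.cong[OF refl])
    fix j assume "j \<in> {..<DIM('a)}"
    then have j: "j < DIM('a)" by simp
    note ET = local_onfD(2)[OF Mg E j p]
    have "E j p = (\<Sum>i<DIM('a). g p (E j p) (e i p) \<cdot> e i p)"
      by (rule local_onf_expansion[OF Mg e U'(2) ET])
    also have "\<dots> = (\<Sum>i<DIM('a). x i j p \<cdot> e i p)"
      using metric_sym[OF Mg ET local_onfD(2)[OF Mg e _ U'(2)]] unfolding x_def
      by (intro sum.cong) auto
    finally have "second_form DM N \<phi> D p (E j p) (E j) =
        second_form DM N \<phi> D p (\<Sum>i<DIM('a). x i j p \<cdot> e i p) (E j)" by simp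
    also have "\<dots> = (\<Sum>i<DIM('a). x i j p \<cdot> second_form DM N \<phi> D p (e i p) (E j))"
      by (rule second_form_sum_dir[OF sm N \<phi> DM D W(1) sub(1)[OF j] W(2)])
        (use local_onfD(2)[OF Mg e _ U'(2)] in auto)
    finally show "(\<Sum>i<DIM('a). x i j p \<cdot> second_form DM N \<phi> D p (e i p) (E j)) =
        second_form DM N \<phi> D p (E j p) (E j)" ..
  qed
  finally show ?thesis .
qed

lemma tension_section:
  fixes M :: "('m, 'a::euclidean_space) manifold" and N :: "('n, 'b::euclidean_space) manifold"
  assumes Mg: "riemannian_manifold M g" and N: "smooth_manifold N" and \<phi>: "smooth_map M N \<phi>"
    and DM: "connection_along M M id DM" and D: "connection_along M N \<phi> D"
    and U: "openin (mtop M) U" and E: "local_onf M g U E"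
  shows "section_along M N \<phi> U (tension M g DM N \<phi> D)"
proof -
  note sm = riemannian_smooth[OF Mg]
  have "section_along M N \<phi> U (\<lambda>p. \<Sum>j<DIM('a). second_form DM N \<phi> D p (E j p) (E j))"
    unfolding second_form_def
    by (intro section_sum[OF sm N \<phi> U] section_diff[OF sm N \<phi> U] connection_section[OF D U]
        section_differential[OF sm N \<phi> U] connection_section[OF DM U] local_onfD(1)[OF Mg E]) auto
  then show ?thesis
    by (rule section_cong[OF sm N \<phi> U]) (simp add: tension_frame[OF assms])
qed

text \<open>Differentiating \<open>g q (grad M g f q) (e i q)\<close>, which equals
  \<open>e i q f\<close> on \<open>U\<close>, along \<open>e i\<close> splits by metric
  compatibility. The second product pairs the gradient with the derivative of \<open>e i\<close>
  along itself and is again a derivative of \<open>f\<close>.\<close>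

lemma laplacian_summand:
  fixes M :: "('m, 'a::euclidean_space) manifold"
  assumes Mg: "riemannian_manifold M g" and LC: "levi_civita M g DM"
    and U: "openin (mtop M) U" and e: "local_onf M g U e" and f: "smooth_fun M U f"
    and p: "p \<in> U" and i: "i < DIM('a)"
  shows "g p (DM p (e i p) (grad M g f)) (e i p) = e i p (\<lambda>q. e i q f) - DM p (e i p) (e i) f"
proof -
  note sm = riemannian_smooth[OF Mg]
  have DM: "connection_along M M id DM" using LC unfolding levi_civita_def by blast
  note ei = local_onfD(1)[OF Mg e i] and eT = local_onfD(2)[OF Mg e i]
  have UM: "U \<subseteq> points M" by (rule openin_subset[OF U])
  note G = grad_vector_field[OF Mg U e f]
  have "e i p (\<lambda>q. g q (grad M g f q) (e i q)) =
      g p (DM p (e i p) (grad M g f)) (e i p) + g p (grad M g f p) (DM p (e i p) (e i))"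
    using LC[unfolded levi_civita_def, THEN conjunct2, THEN spec, THEN spec, THEN spec, THEN mp,
        OF conjI, OF U conjI, OF G ei, THEN bspec, OF p, THEN conjunct2, THEN bspec, OF eT[OF p]] .
  moreover have "e i p (\<lambda>q. g q (grad M g f q) (e i q)) = e i p (\<lambda>q. e i q f)"
    by (rule tangent_local[OF sm eT[OF p] U p]) (use metric_grad[OF Mg] eT UM in blast)
  moreover have "g p (grad M g f p) (DM p (e i p) (e i)) = DM p (e i p) (e i) f"
    using connection_tangent[OF DM U ei p eT[OF p]] metric_grad[OF Mg] UM p by auto
  ultimately show ?thesis by simp
qed

text \<open>The factor 2 counts two equal mixed terms: the outer derivative meets \<open>V\<close>
  in the term where the inner one met \<open>f\<close>, and \<open>f\<close> in the term where the
  inner one met \<open>V\<close>. The identity holds for any smooth field \<open>X\<close>;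
  orthonormality enters only on summation.\<close>

lemma hess_summand_scale:
  fixes M :: "('m, 'a::euclidean_space) manifold" and N :: "('n, 'b::euclidean_space) manifold"
  assumes M: "smooth_manifold M" and N: "smooth_manifold N" and \<phi>: "smooth_map M N \<phi>"
    and DM: "connection_along M M id DM" and D: "connection_along M N \<phi> D"
    and U: "openin (mtop M) U" and f: "smooth_fun M U f"
    and V: "section_along M N \<phi> U V" and X: "vector_field M U X" and p: "p \<in> U"
  shows "D p (X p) (\<lambda>q. D q (X q) (\<lambda>r. f r \<cdot> V r)) - D p (DM p (X p) X) (\<lambda>r. f r \<cdot> V r) =
    f p \<cdot> (D p (X p) (\<lambda>q. D q (X q) V) - D p (DM p (X p) X) V)
    + (X p (\<lambda>q. X q f) - DM p (X p) X f) \<cdot> V p + 2 \<cdot> (X p f \<cdot> D p (X p) V)"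
proof -
  have XT: "X q \<in> tangent_space M q" if "q \<in> U" for q
    using section_tangent[OF X that] by simp
  have DXT: "DM p (X p) X \<in> tangent_space M p"
    using connection_tangent[OF DM U X p XT[OF p]] by simp
  note Xf = vector_field_apply[OF X U f]
  note DV = connection_section[OF D U V X]
  \<comment> \<open>The inner Leibniz rule is an equality of sections on \<open>U\<close> only, so
    it is carried under the outer derivative by locality.\<close>
  have "D p (X p) (\<lambda>q. D q (X q) (\<lambda>r. f r \<cdot> V r)) = D p (X p) (\<lambda>q. X q f \<cdot> V q + f q \<cdot> D q (X q) V)"
    by (rule connection_local[OF D U section_add[OF M N \<phi> U section_scale[OF M N \<phi> U Xf V]
            section_scale[OF M N \<phi> U f DV]] p XT[OF p]])
      (rule connection_leibniz[OF D U V _ XT f])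
  also have "\<dots> = (X p (\<lambda>q. X q f) \<cdot> V p + X p f \<cdot> D p (X p) V)
      + (X p f \<cdot> D p (X p) V + f p \<cdot> D p (X p) (\<lambda>q. D q (X q) V))"
    unfolding connection_add[OF D U section_scale[OF M N \<phi> U Xf V] p XT[OF p]
        section_scale[OF M N \<phi> U f DV]]
      connection_leibniz[OF D U V p XT[OF p] Xf] connection_leibniz[OF D U DV p XT[OF p] f] ..
  finally show ?thesis
    unfolding connection_leibniz[OF D U V p DXT f]
    by (simp add: fun_eq_iff tscale_def algebra_simps)
qed

theorem proposition4p3:
  fixes M :: "('m, 'a::euclidean_space) manifold" and g :: "'m \<Rightarrow> 'm tvec \<Rightarrow> 'm tvec \<Rightarrow> real"
    and N :: "('n, 'b::euclidean_space) manifold" and h :: "'n \<Rightarrow> 'n tvec \<Rightarrow> 'n tvec \<Rightarrow> real"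
    and DM :: "('m, 'm) cov" and DN :: "('n, 'n) cov" and D :: "('m, 'n) cov"
    and \<phi> :: "'m \<Rightarrow> 'n" and f :: "'m \<Rightarrow> real"
  assumes "riemannian_manifold M g" and "riemannian_manifold N h"
    and "levi_civita M g DM" and "levi_civita N h DN"
    and "smooth_map M N \<phi>" and "pullback_connection M N \<phi> DN D"
    and "smooth_fun M (points M) f" and "\<forall>p\<in>points M. f p > 0"
  shows "\<forall>p\<in>points M.
    f_bitension M g DM N DN \<phi> D f p =
      f p \<cdot> bitension M g DM N DN \<phi> D p
      - laplacian M g DM f p \<cdot> tension M g DM N \<phi> D p
      - 2 \<cdot> D p (grad M g f p) (tension M g DM N \<phi> D)"
proof
  fix p assume p: "p \<in> points M"
  note M = riemannian_smooth[OF assms(1)] and N = riemannian_smooth[OF assms(2)]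
  have DM: "connection_along M M id DM" using assms(3) unfolding levi_civita_def by blast
  have D: "connection_along M N \<phi> D" using assms(6) unfolding pullback_connection_def by blast
  obtain e U where U: "openin (mtop M) U" "p \<in> U" and e: "local_onf M g U e"
    and trR: "\<And>B. trace_at M g p B = (\<Sum>i<DIM('a). B (e i) :: real)"
    and trN: "\<And>B. trace_at M g p B = (\<Sum>i<DIM('a). B (e i) :: 'n tvec)"
    using trace_at_frame[OF assms(1) p] by metis
  define \<tau> where "\<tau> = tension M g DM N \<phi> D"
  have f: "smooth_fun M U f" by (rule smooth_fun_subset[OF assms(7) openin_subset[OF U(1)]])
  have \<tau>: "section_along M N \<phi> U \<tau>"
    unfolding \<tau>_def by (rule tension_section[OF assms(1) N assms(5) DM D U(1) e])
  have lap: "laplacian M g DM f p = (\<Sum>i<DIM('a). e i p (\<lambda>q. e i q f) - DM p (e i p) (e i) f)"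
    unfolding laplacian_def divergence_def trR
    by (intro sum.cong refl laplacian_summand[OF assms(1,3) U(1) e f U(2)]) simp
  have gr: "D p (grad M g f p) \<tau> = (\<Sum>i<DIM('a). e i p f \<cdot> D p (e i p) \<tau>)"
    unfolding grad_frame[OF assms(1) p e U(2)]
    by (rule connection_sum_dir[OF D U(1) M N assms(5) \<tau> U(2)])
      (use local_onfD(2)[OF assms(1) e _ U(2)] in auto)
  have "trace_hess M g DM D (\<lambda>q. f q \<cdot> \<tau> q) p = (\<Sum>i<DIM('a).
      f p \<cdot> (D p (e i p) (\<lambda>q. D q (e i q) \<tau>) - D p (DM p (e i p) (e i)) \<tau>)
      + (e i p (\<lambda>q. e i q f) - DM p (e i p) (e i) f) \<cdot> \<tau> p + 2 \<cdot> (e i p f \<cdot> D p (e i p) \<tau>))"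
    unfolding trace_hess_def trN
    by (intro sum.cong refl hess_summand_scale[OF M N assms(5) DM D U(1) f \<tau> _ U(2)]
        local_onfD(1)[OF assms(1) e]) simp
  also have "\<dots> = f p \<cdot> trace_hess M g DM D \<tau> p + laplacian M g DM f p \<cdot> \<tau> p
      + 2 \<cdot> D p (grad M g f p) \<tau>"
    unfolding trace_hess_def trN lap gr
    by (simp add: fun_eq_iff tscale_def sum_fun_apply sum.distrib sum_distrib_left sum_distrib_right)
  finally show "f_bitension M g DM N DN \<phi> D f p =
      f p \<cdot> bitension M g DM N DN \<phi> D p - laplacian M g DM f p \<cdot> tension M g DM N \<phi> D p
      - 2 \<cdot> D p (grad M g f p) (tension M g DM N \<phi> D)"
    unfolding f_bitension_def bitension_def Let_def \<tau>_def[symmetric]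
    by (simp add: fun_eq_iff tscale_def algebra_simps)
qed

end
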